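(* Let $X$ be a homogeneous polynomial vector field of degree $2$ on $\mathbb S^2$. If $X$ has a limit cycle on $\mathbb S^2$, then after an orthogonal linear change of variables of $\mathbb R^3$ the system associated to $X$ belongs to one of the following two families: (i) $$\begin{aligned}\dot x&=a_5yz-y(-a_1x-a_2y),\\ \dot y&=x(-a_1x-a_2y)-z(-a_7x-a_8y),\\ \dot z&=y(-a_7x-a_8y)-a_5xy,\end{aligned}$$ with real coefficients such that $a_1\neq0$, $a_2(a_5+a_7)-a_1a_8\neq0$ and $-a_5a_7<0$; (ii) $$\begin{aligned}\dot x&=c_5yz-y(-c_1x-c_2y),\\ \dot y&=x(-c_1x-c_2y)-z\Big(-c_7x-\tfrac{c_2(c_5+c_7)}{c_1}y\Big),\\ \dot z&=y\Big(-c_7x-\tfrac{c_2(c_5+c_7)}{c_1}y\Big)-c_5xy,\end{aligned}$$ with real coefficients such that $c_1\neq0$ and $-c_5c_7<0$.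
   Context: $\mathbb S^2=\{(x,y,z)\in\mathbb R^3: x^2+y^2+z^2=1\}$. A homogeneous polynomial vector field of degree $n$ on $\mathbb S^2$ is a vector field $X=(P,Q,R)$ on $\mathbb R^3$ whose components are real homogeneous polynomials of degree $n$ with $xP+yQ+zR=0$ at all points of $\mathbb S^2$; one studies its flow restricted to $\mathbb S^2$. A limit cycle is a periodic orbit that is isolated in the set of all periodic orbits of $X$ on $\mathbb S^2$. *)

theory Defs
  imports "HOL-Analysis.Analysis"
begin

definition homogeneous_poly3 :: "nat \<Rightarrow> (real^3 \<Rightarrow> real) \<Rightarrow> bool" where
  "homogeneous_poly3 n f \<longleftrightarrow>
     (\<exists>c :: nat \<Rightarrow> nat \<Rightarrow> real. \<forall>v.
        f v = (\<Sum>i\<le>n. \<Sum>j\<le>n - i. c i j * (v $ 1) ^ i * (v $ 2) ^ j * (v $ 3) ^ (n - i - j)))"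

definition homogeneous_poly_vector_field :: "nat \<Rightarrow> (real^3 \<Rightarrow> real^3) \<Rightarrow> bool" where
  "homogeneous_poly_vector_field n X \<longleftrightarrow>
     (\<forall>i. homogeneous_poly3 n (\<lambda>v. X v $ i)) \<and>
     (\<forall>v \<in> sphere 0 1.
        v $ 1 * X v $ 1 + v $ 2 * X v $ 2 + v $ 3 * X v $ 3 = 0)"

(* Solutions are taken on all of R: the sphere is compact, so every maximal
   solution starting on it is global. Equilibria are not periodic orbits. *)
definition periodic_orbit :: "(real^3 \<Rightarrow> real^3) \<Rightarrow> (real^3) set \<Rightarrow> bool" where
  "periodic_orbit X \<gamma> \<longleftrightarrow>
     (\<exists>(u :: real \<Rightarrow> real^3) T.
        (\<forall>t. (u has_vector_derivative X (u t)) (at t)) \<and>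
        range u \<subseteq> sphere 0 1 \<and>
        T > 0 \<and> (\<forall>t. u (t + T) = u t) \<and>
        \<not> u constant_on UNIV \<and>
        \<gamma> = range u)"

(* Isolation: some neighbourhood of the orbit in the sphere contains no other
   periodic orbit. *)
definition limit_cycle :: "(real^3 \<Rightarrow> real^3) \<Rightarrow> (real^3) set \<Rightarrow> bool" where
  "limit_cycle X \<gamma> \<longleftrightarrow>
     periodic_orbit X \<gamma> \<and>
     (\<exists>U. openin (top_of_set (sphere 0 1)) U \<and> \<gamma> \<subseteq> U \<and>
          (\<forall>\<gamma>'. periodic_orbit X \<gamma>' \<and> \<gamma>' \<subseteq> U \<longrightarrow> \<gamma>' = \<gamma>))"

(* The field governing w = T v when v' = X v. *)
definition change_variables ::
    "(real^3 \<Rightarrow> real^3) \<Rightarrow> (real^3 \<Rightarrow> real^3) \<Rightarrow> real^3 \<Rightarrow> real^3" where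
  "change_variables T X = (\<lambda>w. T (X (inv T w)))"

definition family_i :: "(real^3 \<Rightarrow> real^3) \<Rightarrow> bool" where
  "family_i Y \<longleftrightarrow>
     (\<exists>a1 a2 a5 a7 a8 :: real.
        a1 \<noteq> 0 \<and> a2 * (a5 + a7) - a1 * a8 \<noteq> 0 \<and> - (a5 * a7) < 0 \<and>
        (\<forall>x y z. Y (vector [x, y, z]) = vector
           [a5 * y * z - y * (- a1 * x - a2 * y),
            x * (- a1 * x - a2 * y) - z * (- a7 * x - a8 * y),
            y * (- a7 * x - a8 * y) - a5 * x * y]))"

definition family_ii :: "(real^3 \<Rightarrow> real^3) \<Rightarrow> bool" where
  "family_ii Y \<longleftrightarrow>
     (\<exists>c1 c2 c5 c7 :: real.
        c1 \<noteq> 0 \<and> - (c5 * c7) < 0 \<and>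
        (\<forall>x y z. Y (vector [x, y, z]) = vector
           [c5 * y * z - y * (- c1 * x - c2 * y),
            x * (- c1 * x - c2 * y) - z * (- c7 * x - c2 * (c5 + c7) / c1 * y),
            y * (- c7 * x - c2 * (c5 + c7) / c1 * y) - c5 * x * y]))"

end

theory Submission
  imports Defs
begin

text \<open>
  The relation \<open>x P + y Q + z R = 0\<close> forces \<open>X v = v \<times> (M v)\<close> for a 3x3 matrix \<open>M\<close>, which matters only
  modulo multiples of the identity. Rotate an eigenvector of \<open>M\<close> to the third axis and shift \<open>M\<close> so
  that its eigenvalue becomes 0; then \<open>z'\<close> is the quadratic form \<open>det ((x, y), N (x, y))\<close>,
  where \<open>N\<close> is the upper left 2x2 block. If \<open>N\<close> has no two distinct real eigenvalues, this form is
  semidefinite, hence \<open>z\<close> is monotone and there is no periodic orbit, unless \<open>N\<close> is scalar. So if \<open>M\<close>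
  does not have three distinct real eigenvalues, a suitable choice of the eigenvector rules out limit
  cycles. Otherwise we put the middle eigenvalue on the third axis, so that \<open>det N < 0\<close>, and an
  eigenvector of \<open>N\<close> on the first axis; the result is of type (i) or (ii) as soon as \<open>a\<^sub>1 \<noteq> 0\<close>, and
  if this fails for both eigenvectors of \<open>N\<close>, then \<open>M\<close> is block diagonal.

  In the two degenerate cases (\<open>N\<close> scalar, \<open>M\<close> block diagonal) the field is reversible with respect to
  the reflection in a plane that every periodic orbit meets. The orbits which meet this plane at nearby
  points meet it a second time by transversality, so they are periodic too, and no periodic orbit is
  isolated.
\<close>

section \<open>Flows of Lipschitz fields on the sphere\<close>

lemma continuous_has_antiderivative_on_line:
  fixes g :: "real \<Rightarrow> 'a::banach"
  assumes "continuous_on UNIV g"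
  obtains G where "G 0 = 0" "\<And>t. (G has_vector_derivative g t) (at t)"
proof -
  \<comment> \<open>An integral over an empty or one-point interval is 0, so this difference is the
    signed integral from 0 to \<open>t\<close> for either sign of \<open>t\<close>.\<close>
  define G where "G = (\<lambda>t. integral {0..t} g - integral {t..0} g)"
  have "(G has_vector_derivative g t) (at t)" for t
  proof -
  define N where "N = \<bar>t\<bar> + 1"
  have cont: "continuous_on {a..b} g" for a b
    using assms continuous_on_subset by blast
  have G: "G s = integral {-N..s} g - integral {-N..0} g" if "s \<in> {-N..N}" for s
  proof (cases "s \<ge> 0")
    case True
    have "integral {-N..0} g + integral {0..s} g = integral {-N..s} g"
      using True that by (intro Henstock_Kurzweil_Integration.integral_combine
        integrable_continuous_real cont) (auto simp: N_def)
    moreover have "integral {s..0} g = 0"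
      using True by (cases "s = 0") auto
    ultimately show ?thesis
      by (simp add: G_def algebra_simps)
  next
    case False
    have "integral {-N..s} g + integral {s..0} g = integral {-N..0} g"
      using False that by (intro Henstock_Kurzweil_Integration.integral_combine
        integrable_continuous_real cont) auto
    then show ?thesis
      using False by (simp add: G_def algebra_simps)
  qed
  have "((\<lambda>s. integral {-N..s} g - integral {-N..0} g) has_vector_derivative g t - 0)
          (at t within {-N..N})"
    by (intro derivative_intros integral_has_vector_derivative cont) (auto simp: N_def)
  then have "(G has_vector_derivative g t - 0) (at t within {-N..N})"
    by (rule has_vector_derivative_transform[rotated 2]) (use G in \<open>auto simp: N_def\<close>)
  moreover have "at t within {-N..N} = at t"
    by (rule at_within_interior) (auto simp: N_def interior_atLeastAtMost_real)
  ultimately show ?thesis by simp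
  qed
  moreover have "G 0 = 0" by (simp add: G_def)
  ultimately show thesis using that by blast
qed

text \<open>Integrating the bound on \<open>g\<close> gives the case \<open>t > 0\<close>, and time
  reversal the case \<open>t < 0\<close>. The gained factor \<open>1 / K\<close> is what makes the
  Picard operator below a contraction.\<close>

lemma norm_le_exp_abs_if_derivative_le:
  fixes G :: "real \<Rightarrow> 'a::real_normed_vector"
  assumes G: "G 0 = 0" "\<And>t. (G has_vector_derivative g t) (at t)"
    and K: "0 < K" and C: "0 \<le> C"
    and g: "\<And>t. norm (g t) \<le> C * exp (K * \<bar>t\<bar>)"
  shows "norm (G t) \<le> C / K * exp (K * \<bar>t\<bar>)"
proof -
  have pos: "norm (H s) \<le> C / K * exp (K * s)"
    if "s > 0" "H 0 = 0" "\<And>t. (H has_vector_derivative h t) (at t)"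
      "\<And>t. norm (h t) \<le> C * exp (K * \<bar>t\<bar>)" for H :: "real \<Rightarrow> 'a" and h s
  proof -
    have "norm (H s - H 0) \<le> C / K * exp (K * s) - C / K * exp (K * 0)"
    proof (rule differentiable_bound_general[OF that(1)])
      show "continuous_on {0..s} H"
        using that(3) by (meson continuous_at_imp_continuous_on has_vector_derivative_continuous)
      show "((\<lambda>t. C / K * exp (K * t)) has_vector_derivative C * exp (K * x)) (at x)" for x
        unfolding has_real_derivative_iff_has_vector_derivative[symmetric]
        using K by (auto intro!: derivative_eq_intros)
      show "norm (h x) \<le> C * exp (K * x)" if "0 < x" for x
        using that \<open>\<And>t. norm (h t) \<le> C * exp (K * \<bar>t\<bar>)\<close>[of x] by simp
    qed (use that K in \<open>auto intro!: continuous_intros\<close>)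
    also have "\<dots> \<le> C / K * exp (K * s)"
      using C K by simp
    finally show ?thesis using that by simp
  qed
  consider "t > 0" | "t = 0" | "- t > 0" by linarith
  then show ?thesis
  proof cases
    case 1
    then show ?thesis using pos[of t G g] G g by simp
  next
    case 2
    then show ?thesis using G C K by simp
  next
    case 3
    have "((\<lambda>t. G (- t)) has_vector_derivative - g (- t)) (at t)" for t
      using vector_diff_chain_at[OF has_vector_derivative_minus[OF has_vector_derivative_id] G(2)]
      by (auto simp: o_def)
    moreover have "norm (- g (- t)) \<le> C * exp (K * \<bar>t\<bar>)" for t
      using g[of "- t"] by simp
    ultimately have "norm (G (- (- t))) \<le> C / K * exp (K * (- t))"
      using 3 G by (intro pos[of "- t" "\<lambda>t. G (- t)" "\<lambda>t. - g (- t)"]) auto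
    then show ?thesis using 3 by simp
  qed
qed

lemma lipschitz_ode_solution:
  fixes Y :: "'a::banach \<Rightarrow> 'a"
  assumes lip: "\<And>v w. norm (Y v - Y w) \<le> L * norm (v - w)"
  obtains u where "u 0 = p" "\<And>t. (u has_vector_derivative Y (u t)) (at t)"
proof -
  \<comment> \<open>Large enough for the contraction constant \<open>\<bar>L\<bar> / K\<close> to be
    below 1.\<close>
  define K where "K = 2 * (\<bar>L\<bar> + 1)"
  have K: "0 < K" and LK: "0 \<le> \<bar>L\<bar> / K" "\<bar>L\<bar> / K < 1"
    by (auto simp: K_def field_simps)
  have lip': "norm (Y v - Y w) \<le> \<bar>L\<bar> * norm (v - w)" for v w
    using lip[of v w] mult_right_mono[of L "\<bar>L\<bar>" "norm (v - w)"] by (meson abs_ge_self norm_ge_zero order_trans)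
  have contY: "continuous_on UNIV Y"
    by (rule lipschitz_on_continuous_on[of "\<bar>L\<bar>"], rule lipschitz_onI)
      (auto simp: dist_norm lip')
  \<comment> \<open>A bounded continuous \<open>w\<close> stands for the possibly unbounded curve
    \<open>exp (K * \<bar>s\<bar>) *\<^sub>R w s\<close>; \<open>F w\<close> is the field along that
    curve.\<close>
  define F where "F = (\<lambda>w s. Y (exp (K * \<bar>s\<bar>) *\<^sub>R apply_bcontfun w s))"
  have contF: "continuous_on UNIV (F w)" for w
    unfolding F_def by (intro continuous_on_compose2[OF contY] continuous_intros) auto
  have "\<forall>w. \<exists>G. G 0 = 0 \<and> (\<forall>t. (G has_vector_derivative F w t) (at t))"
    using continuous_has_antiderivative_on_line[OF contF] by metis
  then obtain A where A0: "\<And>w. A w 0 = 0"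
    and A: "\<And>w t. (A w has_vector_derivative F w t) (at t)"
    by metis
  \<comment> \<open>The weight \<open>exp (- K * \<bar>t\<bar>)\<close> makes the Picard operator a contraction on the whole line.\<close>
  define P where "P = (\<lambda>w t. exp (- (K * \<bar>t\<bar>)) *\<^sub>R (p + A w t))"
  have contA: "continuous_on UNIV (A w)" for w
    using A by (meson continuous_at_imp_continuous_on has_vector_derivative_continuous)
  have bound: "norm (P w t) \<le> norm p + (norm (Y 0) + \<bar>L\<bar> * norm w) / K" for w t
  proof -
    have "norm (F w s) \<le> (norm (Y 0) + \<bar>L\<bar> * norm w) * exp (K * \<bar>s\<bar>)" for s
    proof -
      have "norm (F w s) \<le> norm (Y 0) + norm (F w s - Y 0)"
        using norm_triangle_sub by blast
      also have "norm (F w s - Y 0) \<le> \<bar>L\<bar> * (exp (K * \<bar>s\<bar>) * norm (apply_bcontfun w s))"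
        unfolding F_def using lip'[of _ 0] by (metis abs_exp_cancel diff_zero norm_scaleR)
      also have "\<dots> \<le> \<bar>L\<bar> * (exp (K * \<bar>s\<bar>) * norm w)"
        by (intro mult_left_mono norm_bounded) auto
      also have "norm (Y 0) \<le> norm (Y 0) * exp (K * \<bar>s\<bar>)"
        using K by (simp add: mult_le_cancel_left1)
      finally show ?thesis by (simp add: algebra_simps)
    qed
    then have *: "norm (A w t) \<le> (norm (Y 0) + \<bar>L\<bar> * norm w) / K * exp (K * \<bar>t\<bar>)"
      by (intro norm_le_exp_abs_if_derivative_le[OF A0 A K]) auto
    have "norm (P w t) \<le> exp (- (K * \<bar>t\<bar>)) * (norm p + norm (A w t))"
      unfolding P_def by (simp add: norm_triangle_ineq)
    also have "\<dots> = exp (- (K * \<bar>t\<bar>)) * norm p + exp (- (K * \<bar>t\<bar>)) * norm (A w t)"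
      by (simp add: algebra_simps)
    also have "exp (- (K * \<bar>t\<bar>)) * norm p \<le> norm p"
      using K by (intro mult_left_le_one_le) auto
    also have "exp (- (K * \<bar>t\<bar>)) * norm (A w t) \<le> (norm (Y 0) + \<bar>L\<bar> * norm w) / K"
      using * by (simp add: exp_minus field_simps)
    finally show ?thesis by simp
  qed
  have contP: "continuous_on UNIV (P w)" for w
    unfolding P_def by (intro continuous_intros contA)
  have P: "apply_bcontfun (Bcontfun (P w)) = P w" for w
    using bcontfun_normI[OF contP bound] by (simp add: Bcontfun_inverse)
  have "dist (Bcontfun (P v)) (Bcontfun (P w)) \<le> \<bar>L\<bar> / K * dist v w" for v w
  proof (rule dist_bound)
    fix t
    have "norm (F v s - F w s) \<le> \<bar>L\<bar> * dist v w * exp (K * \<bar>s\<bar>)" for s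
    proof -
      have "norm (F v s - F w s) \<le> \<bar>L\<bar> * (exp (K * \<bar>s\<bar>) * dist (apply_bcontfun v s) (apply_bcontfun w s))"
        unfolding F_def dist_norm using lip'
        by (metis abs_exp_cancel norm_scaleR scaleR_right_diff_distrib)
      also have "\<dots> \<le> \<bar>L\<bar> * (exp (K * \<bar>s\<bar>) * dist v w)"
        by (intro mult_left_mono dist_bounded) auto
      finally show ?thesis by (simp add: algebra_simps)
    qed
    then have "norm (A v t - A w t) \<le> \<bar>L\<bar> * dist v w / K * exp (K * \<bar>t\<bar>)"
      by (intro norm_le_exp_abs_if_derivative_le[of "\<lambda>t. A v t - A w t" "\<lambda>t. F v t - F w t"]
          has_vector_derivative_diff A K) (auto simp: A0)
    moreover have "dist (P v t) (P w t) = exp (- (K * \<bar>t\<bar>)) * norm (A v t - A w t)"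
      unfolding P_def dist_norm scaleR_diff_right[symmetric] by simp
    ultimately have "dist (P v t) (P w t)
        \<le> exp (- (K * \<bar>t\<bar>)) * (\<bar>L\<bar> * dist v w / K * exp (K * \<bar>t\<bar>))"
      using mult_left_mono exp_ge_zero by metis
    also have "\<dots> = \<bar>L\<bar> * dist v w / K"
      by (simp add: exp_minus)
    finally have "dist (P v t) (P w t) \<le> \<bar>L\<bar> / K * dist v w"
      by simp
    then show "dist (apply_bcontfun (Bcontfun (P v)) t) (apply_bcontfun (Bcontfun (P w)) t)
        \<le> \<bar>L\<bar> / K * dist v w"
      unfolding P .
  qed
  then obtain w where w: "Bcontfun (P w) = w"
    using banach_fix_type[OF LK, of "\<lambda>w. Bcontfun (P w)"] by blast
  show thesis
  proof
    let ?u = "\<lambda>t. p + A w t"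
    show "?u 0 = p" by (simp add: A0)
    fix t
    have "apply_bcontfun w t = exp (- (K * \<bar>t\<bar>)) *\<^sub>R ?u t"
      using P[of w] unfolding w by (simp add: P_def)
    then have "F w t = Y (?u t)"
      by (simp add: F_def exp_add[symmetric])
    then show "(?u has_vector_derivative Y (?u t)) (at t)"
      using has_vector_derivative_add[OF has_vector_derivative_const A[of w t]] by simp
  qed
qed

text \<open>Gronwall's argument: the squared distance \<open>D\<close> satisfies
  \<open>\<bar>D'\<bar> \<le> 2 * L * D\<close>, so \<open>D\<close> times the matching exponential
  is monotone on either side of time 0.\<close>

lemma norm_diff_solutions_le:
  fixes u w :: "real \<Rightarrow> 'a::real_inner"
  assumes lip: "\<And>v w. v \<in> S \<Longrightarrow> w \<in> S \<Longrightarrow> norm (X v - X w) \<le> L * norm (v - w)"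
    and u: "\<And>t. (u has_vector_derivative X (u t)) (at t)" "\<And>t. u t \<in> S"
    and w: "\<And>t. (w has_vector_derivative X (w t)) (at t)" "\<And>t. w t \<in> S"
  shows "norm (u t - w t) \<le> exp (L * \<bar>t\<bar>) * norm (u 0 - w 0)"
proof -
  define D where "D = (\<lambda>t. (u t - w t) \<bullet> (u t - w t))"
  define d where "d = (\<lambda>t. 2 * ((u t - w t) \<bullet> (X (u t) - X (w t))))"
  have D: "(D has_real_derivative d t) (at t)" for t
  proof -
    have "((\<lambda>t. u t - w t) has_vector_derivative X (u t) - X (w t)) (at t)"
      by (intro derivative_intros u w)
    from bounded_bilinear.has_vector_derivative[OF bounded_bilinear_inner this this]
    show ?thesis
      by (simp add: D_def d_def has_real_derivative_iff_has_vector_derivative inner_commute)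
  qed
  have d: "\<bar>d t\<bar> \<le> 2 * L * D t" for t
  proof -
    have "\<bar>(u t - w t) \<bullet> (X (u t) - X (w t))\<bar> \<le> norm (u t - w t) * norm (X (u t) - X (w t))"
      by (rule Cauchy_Schwarz_ineq2)
    also have "\<dots> \<le> norm (u t - w t) * (L * norm (u t - w t))"
      by (intro mult_left_mono lip u w) auto
    also have "\<dots> = L * D t"
      by (simp add: D_def power2_norm_eq_inner[symmetric] power2_eq_square)
    finally show ?thesis by (simp add: d_def abs_mult)
  qed
  have "D t \<le> exp (2 * L * \<bar>t\<bar>) * D 0"
  proof (cases "t \<ge> 0")
    case True
    have "exp (- (2 * L * t)) * D t \<le> exp (- (2 * L * 0)) * D 0"
    proof (rule DERIV_nonpos_imp_nonincreasing[OF True, where f = "\<lambda>t. exp (- (2 * L * t)) * D t"])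
      fix x
      have "((\<lambda>t. exp (- (2 * L * t)) * D t) has_real_derivative
          exp (- (2 * L * x)) * (d x - 2 * L * D x)) (at x)"
        by (rule derivative_eq_intros D refl | simp add: algebra_simps)+
      moreover have "exp (- (2 * L * x)) * (d x - 2 * L * D x) \<le> 0"
        using d[of x] by (intro mult_nonneg_nonpos) auto
      ultimately show "\<exists>y. ((\<lambda>t. exp (- (2 * L * t)) * D t) has_real_derivative y) (at x) \<and> y \<le> 0"
        by blast
    qed
    then show ?thesis
      using True by (simp add: exp_minus field_simps)
  next
    case False
    have "exp (2 * L * t) * D t \<le> exp (2 * L * 0) * D 0"
    proof (rule DERIV_nonneg_imp_nondecreasing[where f = "\<lambda>t. exp (2 * L * t) * D t"])
      fix x
      have "((\<lambda>t. exp (2 * L * t) * D t) has_real_derivative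
          exp (2 * L * x) * (d x + 2 * L * D x)) (at x)"
        by (rule derivative_eq_intros D refl | simp add: algebra_simps)+
      moreover have "0 \<le> exp (2 * L * x) * (d x + 2 * L * D x)"
        using d[of x] by (intro mult_nonneg_nonneg) auto
      ultimately show "\<exists>y. ((\<lambda>t. exp (2 * L * t) * D t) has_real_derivative y) (at x) \<and> 0 \<le> y"
        by blast
    qed (use False in simp)
    then show ?thesis
      using False by (simp add: exp_minus field_simps)
  qed
  then have "(norm (u t - w t))\<^sup>2 \<le> (exp (L * \<bar>t\<bar>) * norm (u 0 - w 0))\<^sup>2"
    by (simp add: D_def power2_norm_eq_inner power_mult_distrib exp_double[symmetric] mult.assoc)
  then show ?thesis
    by (rule power2_le_imp_le) simp
qed

text \<open>The retraction onto the unit ball turns a field that is Lipschitz on the ball into one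
  that is Lipschitz everywhere, as global existence of solutions requires.\<close>

lemma norm_radial_retraction_diff_le:
  fixes v w :: "'a::real_normed_vector"
  shows "norm (v /\<^sub>R max 1 (norm v) - w /\<^sub>R max 1 (norm w)) \<le> 2 * norm (v - w)"
proof -
  define a b where "a = max 1 (norm v)" and "b = max 1 (norm w)"
  have ab: "a \<ge> 1" "b \<ge> 1" "norm w \<le> b" by (auto simp: a_def b_def)
  have "\<bar>b - a\<bar> \<le> norm (v - w)"
    unfolding a_def b_def using norm_triangle_ineq3[of v w] by (auto simp: max_def)
  have "v /\<^sub>R a - w /\<^sub>R b = (v - w) /\<^sub>R a + ((b - a) / a) *\<^sub>R (w /\<^sub>R b)"
  proof -
    have "(b - a) / a / b = inverse a - inverse b"
      using ab by (simp add: field_simps)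
    then show ?thesis
      by (simp add: scaleR_diff_right scaleR_diff_left divide_inverse)
  qed
  also have "norm \<dots> \<le> norm ((v - w) /\<^sub>R a) + norm (((b - a) / a) *\<^sub>R (w /\<^sub>R b))"
    by (rule norm_triangle_ineq)
  also have "norm ((v - w) /\<^sub>R a) \<le> norm (v - w)"
    using ab mult_left_mono[of 1 a "norm (v - w)"] unfolding norm_scaleR by (simp add: field_simps)
  also have "norm (((b - a) / a) *\<^sub>R (w /\<^sub>R b)) \<le> \<bar>b - a\<bar> / a * 1"
    unfolding norm_scaleR using ab by (intro mult_mono) (auto simp: field_simps)
  also have "\<dots> \<le> \<bar>b - a\<bar>"
    using ab mult_left_mono[of 1 a "\<bar>b - a\<bar>"] by (simp add: field_simps)
  finally show ?thesis
    using \<open>\<bar>b - a\<bar> \<le> norm (v - w)\<close> by (simp add: a_def b_def)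
qed

text \<open>Solve for the globally Lipschitz field \<open>X (r v)\<close>, where \<open>r\<close> is
  the radial retraction. Since \<open>v\<close> is a multiple of \<open>r v\<close>, this field is
  still orthogonal to \<open>v\<close>, so the norm is conserved and the solution stays where
  \<open>r\<close> is the identity.\<close>

lemma tangent_field_solution_on_sphere:
  fixes X :: "'a::{real_inner,banach} \<Rightarrow> 'a"
  assumes lip: "\<And>v w. v \<in> cball 0 1 \<Longrightarrow> w \<in> cball 0 1 \<Longrightarrow> norm (X v - X w) \<le> L * norm (v - w)"
    and tangent: "\<And>v. v \<bullet> X v = 0" and p: "norm p = 1"
  obtains u where "u 0 = p" "\<And>t. (u has_vector_derivative X (u t)) (at t)" "\<And>t. norm (u t) = 1"
proof -
  define r :: "'a \<Rightarrow> 'a" where "r = (\<lambda>v. v /\<^sub>R max 1 (norm v))"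
  have r: "norm (r v) \<le> 1" for v
    by (auto simp: r_def max_def field_simps)
  have L: "0 \<le> L" 
    using order_trans[OF norm_ge_zero lip[of p 0]] p by simp
  have "norm (X (r v) - X (r w)) \<le> (L * 2) * norm (v - w)" for v w
  proof -
    have "norm (X (r v) - X (r w)) \<le> L * norm (r v - r w)"
      using r by (intro lip) auto
    also have "\<dots> \<le> L * (2 * norm (v - w))"
      unfolding r_def by (intro mult_left_mono norm_radial_retraction_diff_le L)
    finally show ?thesis by simp
  qed
  from lipschitz_ode_solution[of "\<lambda>v. X (r v)", OF this]
  obtain u where u: "u 0 = p" "\<And>t. (u has_vector_derivative X (r (u t))) (at t)"
    by blast
  have orth: "v \<bullet> X (r v) = 0" for v
  proof -
    have "v = max 1 (norm v) *\<^sub>R r v" by (simp add: r_def)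
    then show ?thesis using tangent[of "r v"] by (metis inner_scaleR_left mult_zero_right)
  qed
  have "((\<lambda>t. u t \<bullet> u t) has_real_derivative 0) (at t)" for t
    using bounded_bilinear.has_vector_derivative[OF bounded_bilinear_inner u(2)[of t] u(2)[of t]]
    by (simp add: has_real_derivative_iff_has_vector_derivative inner_commute orth)
  then have "u t \<bullet> u t = u 0 \<bullet> u 0" for t
    using DERIV_isconst_all by blast
  then have norm: "norm (u t) = 1" for t
    using p u(1) by (simp add: norm_eq_sqrt_inner)
  then have "r (u t) = u t" for t by (simp add: r_def)
  then show thesis using that u norm by simp
qed

section \<open>Reversible flows\<close>

lemma simple_zero_sign_change:
  fixes f :: "real \<Rightarrow> real"
  assumes "(f has_real_derivative D) (at x)" "D \<noteq> 0" "f x = 0" "e > 0"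
  obtains a b where "x - e < a" "a < x" "x < b" "b < x + e" "f a * f b < 0"
proof -
  note result = that
  \<comment> \<open>Only products of values matter, so a negative derivative is handled by passing
    to \<open>- f\<close>.\<close>
  have *: thesis if g: "(g has_real_derivative E) (at x)" "E > 0" "g x = 0"
    "\<And>a b. f a * f b = g a * g b" for g E
  proof -
    obtain d1 where d1: "d1 > 0" "\<And>h. 0 < h \<Longrightarrow> h < d1 \<Longrightarrow> g x < g (x + h)"
      using DERIV_pos_inc_right[OF g(1,2)] by blast
    obtain d2 where d2: "d2 > 0" "\<And>h. 0 < h \<Longrightarrow> h < d2 \<Longrightarrow> g (x - h) < g x"
      using DERIV_pos_inc_left[OF g(1,2)] by blast
    define d where "d = min e (min d1 d2) / 2"
    have d: "0 < d" "d < e" "d < d1" "d < d2"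
      using assms d1 d2 by (auto simp: d_def)
    have "g (x - d) * g (x + d) < 0"
      using d d1(2)[of d] d2(2)[of d] g(3) by (intro mult_neg_pos) auto
    then show thesis
      using d g(4)[of "x - d" "x + d"] result[of "x - d" "x + d"] by simp
  qed
  show thesis
  proof (cases "D > 0")
    case True
    then show thesis using *[of f D] assms by blast
  next
    case False
    then show thesis
      using *[of "\<lambda>t. - f t" "- D"] assms by (auto intro: derivative_intros)
  qed
qed

text \<open>Infinitely many zeros would accumulate at a point of the compact interval. That point is
  again a zero, and difference quotients vanishing arbitrarily close to it contradict a nonzero
  derivative.\<close>

lemma finite_simple_zeros:
  fixes f :: "real \<Rightarrow> real"
  assumes "\<And>t. (f has_real_derivative f' t) (at t)" "\<And>t. f t = 0 \<Longrightarrow> f' t \<noteq> 0"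
  shows "finite {t \<in> {a..b}. f t = 0}"
proof (rule ccontr)
  assume "infinite {t \<in> {a..b}. f t = 0}"
  then obtain x where x: "x islimpt {t \<in> {a..b}. f t = 0}"
    using Heine_Borel_imp_Bolzano_Weierstrass[of "{a..b}" "{t \<in> {a..b}. f t = 0}"] by blast
  have "closed {t. f t = 0}"
    using assms(1) by (intro closed_Collect_eq continuous_intros)
      (meson DERIV_isCont continuous_at_imp_continuous_on)
  moreover have "x islimpt {t. f t = 0}"
    using x by (rule islimpt_subset) auto
  ultimately have fx: "f x = 0"
    using closed_limpt by blast
  have "((\<lambda>y. (f y - f x) / (y - x)) \<longlongrightarrow> f' x) (at x)"
    using assms(1)[of x] by (simp add: has_field_derivative_iff)
  then have "eventually (\<lambda>y. (f y - f x) / (y - x) \<noteq> 0) (at x)"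
    by (rule tendsto_imp_eventually_ne) (use assms(2) fx in auto)
  then have "eventually (\<lambda>y. y \<notin> {t \<in> {a..b}. f t = 0}) (at x)"
    by eventually_elim (auto simp: fx)
  then show False
    using x by (simp add: islimpt_iff_eventually)
qed

lemma periodic_range_eq:
  fixes u :: "real \<Rightarrow> 'a"
  assumes T: "T > 0" "\<And>t. u (t + T) = u t"
  shows "range u = u ` {a..a + T}"
proof -
  interpret periodic_fun_simple u T by unfold_locales (rule T(2))
  have "u t \<in> u ` {a..a + T}" for t
  proof
    let ?k = "\<lfloor>(t - a) / T\<rfloor>"
    show "u t = u (t - of_int ?k * T)" by (simp add: minus_of_int)
    have "of_int ?k * T \<le> t - a" "t - a < (of_int ?k + 1) * T"
      using T(1) by (simp_all add: floor_divide_lower floor_divide_upper)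
    then show "t - of_int ?k * T \<in> {a..a + T}"
      by (simp add: algebra_simps)
  qed
  then show ?thesis by blast
qed

text \<open>For a unit vector \<open>n\<close> this is the reflection in the hyperplane orthogonal
  to \<open>n\<close>, called the mirror below.\<close>

definition reflect :: "'a::real_inner \<Rightarrow> 'a \<Rightarrow> 'a" where
  "reflect n v = v - (2 * (v \<bullet> n)) *\<^sub>R n"

lemma bounded_linear_reflect: "bounded_linear (reflect n)"
  unfolding reflect_def
  by (intro bounded_linear_sub bounded_linear_ident bounded_linear_compose[OF bounded_linear_scaleR_left]
      bounded_linear_const_mult bounded_linear_inner_left)

lemma reflect_reflect: "norm n = 1 \<Longrightarrow> reflect n (reflect n v) = v"
  by (simp add: reflect_def inner_diff_left norm_eq_1 algebra_simps)

lemma norm_reflect: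
  assumes "norm n = 1" shows "norm (reflect n v) = norm v"
proof -
  have "reflect n v \<bullet> reflect n v = v \<bullet> v"
    using assms by (simp add: reflect_def inner_diff_left inner_diff_right norm_eq_1
        inner_commute algebra_simps)
  then show ?thesis by (simp add: norm_eq_sqrt_inner)
qed

lemma reflect_eq_self_iff: "norm n = 1 \<Longrightarrow> reflect n v = v \<longleftrightarrow> v \<bullet> n = 0"
  by (auto simp: reflect_def)

text \<open>Tangency is asked at every point of the space because the existence proof also evaluates
  the field at retracted points inside the ball.\<close>

locale sphere_flow =
  fixes X :: "'a::euclidean_space \<Rightarrow> 'a" and L :: real
  assumes lipschitz: "v \<in> cball 0 1 \<Longrightarrow> w \<in> cball 0 1 \<Longrightarrow> norm (X v - X w) \<le> L * norm (v - w)"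
    and tangent: "v \<bullet> X v = 0"
begin

definition solution :: "(real \<Rightarrow> 'a) \<Rightarrow> bool" where
  "solution u \<longleftrightarrow> (\<forall>t. (u has_vector_derivative X (u t)) (at t)) \<and> (\<forall>t. norm (u t) = 1)"

lemma solution_exists:
  assumes "norm p = 1"
  obtains u where "solution u" "u 0 = p"
  using tangent_field_solution_on_sphere[of X L p] lipschitz tangent assms
  unfolding solution_def by metis

lemma solution_shift: "solution u \<Longrightarrow> solution (\<lambda>t. u (t + c))"
  unfolding solution_def
  by (auto simp: o_def intro!: vector_diff_chain_at[of "\<lambda>t. t + c" 1 _ u "X (u (_ + c))", simplified o_def scaleR_one]
      derivative_eq_intros)

lemma solution_norm_diff_le:
  assumes "solution u" "solution w"
  shows "norm (u t - w t) \<le> exp (L * \<bar>t\<bar>) * norm (u 0 - w 0)"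
  using assms unfolding solution_def
  by (intro norm_diff_solutions_le[of "cball 0 1" X L] lipschitz) auto

lemma solution_unique:
  assumes "solution u" "solution w" "u 0 = w 0"
  shows "u t = w t"
  using solution_norm_diff_le[OF assms(1,2), of t] assms(3) by simp

lemma solution_constant:
  assumes "solution u" "X (u c) = 0"
  shows "u t = u c"
proof -
  have "solution (\<lambda>t. u c)"
    using assms by (auto simp: solution_def)
  then show ?thesis
    using solution_unique[OF solution_shift[OF assms(1), of c], of "\<lambda>t. u c" "t - c"] by simp
qed

lemma solution_continuous: "solution u \<Longrightarrow> continuous_on S u"
  unfolding solution_def
  by (meson continuous_at_imp_continuous_on has_vector_derivative_continuous)

lemma solution_inner_derivative:
  assumes "solution u"
  shows "((\<lambda>t. u t \<bullet> b) has_real_derivative X (u t) \<bullet> b) (at t)"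
  unfolding has_real_derivative_iff_has_vector_derivative
  using assms by (auto simp: solution_def
      intro!: bounded_linear.has_vector_derivative[OF bounded_linear_inner_left])

end

text \<open>The minus sign means that the reflection carries solutions to solutions run backwards in
  time.\<close>

locale reversible_sphere_flow = sphere_flow +
  fixes n
  assumes norm_n: "norm n = 1" and reversible: "X (reflect n v) = - reflect n (X v)"
begin

text \<open>The reflected, time-reversed curve is a solution, and at time \<open>c\<close> it passes
  through the same mirror point; uniqueness identifies the two.\<close>

lemma solution_symmetric:
  assumes u: "solution u" and "u c \<bullet> n = 0"
  shows "u (c - t) = reflect n (u (c + t))"
proof -
  interpret bounded_linear "reflect n" by (rule bounded_linear_reflect)
  have "solution (\<lambda>t. reflect n (u (c - t)))"
    unfolding solution_def
  proof (intro conjI allI)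
    fix t
    have "((\<lambda>t. u (c - t)) has_vector_derivative (- 1) *\<^sub>R X (u (c - t))) (at t)"
      using u unfolding solution_def
      by (intro vector_diff_chain_at[of "\<lambda>t. c - t" "- 1" _ u "X (u (c - t))", simplified o_def])
        (auto intro!: derivative_eq_intros)
    then show "((\<lambda>t. reflect n (u (c - t))) has_vector_derivative X (reflect n (u (c - t)))) (at t)"
      using has_vector_derivative by (fastforce simp: reversible neg)
    show "norm (reflect n (u (c - t))) = 1"
      using u by (simp add: norm_reflect norm_n solution_def)
  qed
  from solution_unique[OF this solution_shift[OF u, of c], of t]
  have "reflect n (u (c - t)) = u (c + t)"
    using assms reflect_eq_self_iff[OF norm_n] by (simp add: add.commute)
  then show ?thesis
    using reflect_reflect[OF norm_n] by metis
qed

text \<open>The orbit is symmetric under the time reversals about \<open>c\<close> and about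
  \<open>d\<close>; their composition is the translation by \<open>2 * (d - c)\<close>.\<close>

lemma solution_periodic:
  assumes u: "solution u" "u c \<bullet> n = 0" "u d \<bullet> n = 0"
  shows "u (t + 2 * (d - c)) = u t"
proof -
  have "u (2 * c - t) = reflect n (u t)"
    using solution_symmetric[OF u(1,2), of "t - c"] by simp
  moreover have "u (2 * c - t) = reflect n (u (t + 2 * (d - c)))"
    using solution_symmetric[OF u(1,3), of "t + d - 2 * c"] by (simp add: algebra_simps)
  ultimately show ?thesis
    using reflect_reflect[OF norm_n] by metis
qed

text \<open>On the mirror, reversibility makes the field normal to it. Hence an orbit without
  equilibria crosses the mirror transversally.\<close>

lemma field_on_mirror:
  assumes "v \<bullet> n = 0" "X v \<bullet> n = 0" shows "X v = 0"
proof -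
  have "reflect n v = v" "reflect n (X v) = X v"
    using assms by (simp_all add: reflect_eq_self_iff norm_n)
  then have "2 *\<^sub>R X v = 0"
    using reversible[of v] by (simp add: scaleR_2 eq_neg_iff_add_eq_0)
  then show ?thesis by simp
qed

end

text \<open>The great circle in the mirror through \<open>p\<close> has infinitely many points near
  \<open>p\<close>, so a finite set cannot contain them all.\<close>

lemma nearby_mirror_point:
  fixes p n :: "real^3"
  assumes p: "norm p = 1" "norm n = 1" "p \<bullet> n = 0" and "finite F" "0 < e"
  obtains q where "norm q = 1" "q \<bullet> n = 0" "q \<notin> F" "norm (q - p) < e"
proof -
  define m where "m = cross3 n p"
  have m: "m \<bullet> m = 1" "m \<bullet> p = 0" "m \<bullet> n = 0"
    using norm_cross_dot[of n p] p
    by (simp_all add: m_def dot_cross_self inner_commute power2_norm_eq_inner)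
  define f where "f = (\<lambda>s. cos s *\<^sub>R p + sin s *\<^sub>R m)"
  have pp: "p \<bullet> p = 1" using p by (simp add: norm_eq_1)
  have "isCont f 0"
    unfolding f_def by (intro continuous_intros)
  then obtain d where d: "d > 0" "\<And>s. \<bar>s\<bar> < d \<Longrightarrow> norm (f s - p) < e"
    using \<open>0 < e\<close> unfolding continuous_at_eps_delta by (force simp: f_def dist_norm)
  define I where "I = {0<..<min d 1}"
  have "inj_on f I"
  proof (rule inj_onI)
    fix s t assume "s \<in> I" "t \<in> I" "f s = f t"
    have "f s \<bullet> m = sin s" for s
      using m by (simp add: f_def inner_add_left inner_commute[of p m])
    then have "sin s = sin t" using \<open>f s = f t\<close> by metis
    moreover have "\<bar>s\<bar> \<le> pi / 2" "\<bar>t\<bar> \<le> pi / 2"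
      using \<open>s \<in> I\<close> \<open>t \<in> I\<close> pi_gt3 by (auto simp: I_def)
    ultimately show "s = t"
      by (metis arcsin_sin abs_le_iff minus_le_iff)
  qed
  moreover have "infinite I"
    using d by (simp add: I_def)
  ultimately have "\<not> f ` I \<subseteq> F"
    using \<open>finite F\<close> finite_image_iff finite_subset by blast
  then obtain s where s: "s \<in> I" "f s \<notin> F" by blast
  have "f s \<bullet> f s = (cos s)\<^sup>2 + (sin s)\<^sup>2"
    using m pp by (simp add: f_def inner_add_left inner_add_right inner_commute power2_eq_square)
  then have "norm (f s) = 1" by (simp add: norm_eq_1)
  moreover have "f s \<bullet> n = 0"
    using m p by (simp add: f_def inner_add_left)
  moreover have "norm (f s - p) < e"
    using s d by (auto simp: I_def)
  ultimately show thesis using that s by blast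
qed

lemma (in sphere_flow) not_constant_on_range:
  assumes "solution u" "\<not> u constant_on UNIV"
  shows "X (u t) \<noteq> 0"
  using assms solution_constant unfolding constant_on_def by metis

text \<open>Orbits starting on the mirror near the given one also return to the mirror, since the return is
  transversal; by reversibility they are periodic as well.\<close>
theorem reversible_not_limit_cycle:
  fixes X :: "real^3 \<Rightarrow> real^3"
  assumes "reversible_sphere_flow X L n"
    and u: "sphere_flow.solution X u" "\<not> u constant_on UNIV" "T > 0" "\<And>t. u (t + T) = u t"
    and meets: "u c \<bullet> n = 0"
  shows "\<not> limit_cycle X (range u)"
proof
  interpret reversible_sphere_flow X L n by fact
  assume "limit_cycle X (range u)"
  then obtain O' where O': "open O'" "range u \<subseteq> O'"
    and isolated: "\<And>\<gamma>'. periodic_orbit X \<gamma>' \<Longrightarrow> \<gamma>' \<subseteq> O' \<inter> sphere 0 1 \<Longrightarrow> \<gamma>' = range u"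
    unfolding limit_cycle_def openin_open by (metis Int_commute le_inf_iff)
  define v where "v = (\<lambda>t. u (t + c))"
  have v: "solution v" "v 0 \<bullet> n = 0" "v (t + T) = v t" for t
    using solution_shift[OF u(1), of c] meets u(4)[of "t + c"] by (simp_all add: v_def add.assoc add.commute[of T])
  have range: "range v = range u"
  proof -
    have "u t \<in> range v" for t
      by (rule range_eqI[of _ _ "t - c"]) (simp add: v_def)
    then show ?thesis unfolding v_def by blast
  qed
  have X: "X (v t) \<noteq> 0" for t
    using not_constant_on_range[OF u(1,2)] by (simp add: v_def)
  \<comment> \<open>The times \<open>T / 2\<close> and \<open>- T / 2\<close> give the same point by
    periodicity and mirror images by the symmetry about time 0.\<close>
  have v_half: "v (T / 2) \<bullet> n = 0"
  proof -
    have "v (- (T / 2)) = v (T / 2)"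
      using v(3)[of "- (T / 2)"] by simp
    then have "reflect n (v (T / 2)) = v (T / 2)"
      using solution_symmetric[OF v(1,2), of "T / 2"] by simp
    then show ?thesis
      using reflect_eq_self_iff[OF norm_n] by simp
  qed
  let ?h = "\<lambda>t. v t \<bullet> n"
  have h: "(?h has_real_derivative X (v t) \<bullet> n) (at t)" for t
    by (rule solution_inner_derivative[OF v(1)])
  have simple: "X (v t) \<bullet> n \<noteq> 0" if "v t \<bullet> n = 0" for t
    using field_on_mirror[OF that] X by blast
  obtain a b where ab: "0 < a" "a < b" "b < T" "?h a * ?h b < 0"
    using simple_zero_sign_change[OF h simple[OF v_half] v_half, of "T / 2"] \<open>T > 0\<close>
    by (metis add_diff_cancel_right' diff_self field_sum_of_halves half_gt_zero less_trans)
  have range_v: "range v = v ` {0..0 + T}"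
    by (rule periodic_range_eq[OF \<open>T > 0\<close>]) (rule v(3))
  have "compact (range v)"
    unfolding range_v
    by (intro compact_continuous_image solution_continuous v) auto
  then obtain e where e: "e > 0" "(\<Union>x\<in>range v. ball x e) \<subseteq> O'"
    using compact_subset_open_imp_ball_epsilon_subset[of "range v" O'] O' range by metis
  \<comment> \<open>A curve closer than this to \<open>v\<close> stays in \<open>O'\<close> and
    keeps the signs of \<open>?h\<close> at \<open>a\<close> and \<open>b\<close>.\<close>
  define \<epsilon> where "\<epsilon> = min e (min \<bar>?h a\<bar> \<bar>?h b\<bar>)"
  have \<epsilon>: "\<epsilon> > 0" using e ab by (auto simp: \<epsilon>_def)
  \<comment> \<open>These are the finitely many mirror points of the given orbit; starting outside
    \<open>F\<close> guarantees a different orbit.\<close>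
  define F where "F = v ` {t \<in> {0..0 + T}. ?h t = 0}"
  have F: "x \<in> F" if "x \<in> range v" "x \<bullet> n = 0" for x
    using that unfolding F_def range_v by auto
  have "finite F"
    unfolding F_def by (intro finite_imageI finite_simple_zeros[OF h] simple)
  \<comment> \<open>The exponential offsets the growth allowed by the Gronwall estimate for times up
    to \<open>T\<close> in absolute value.\<close>
  obtain q where q: "norm q = 1" "q \<bullet> n = 0" "q \<notin> F" "norm (q - v 0) < \<epsilon> / exp (\<bar>L\<bar> * T)"
    using nearby_mirror_point[of "v 0" n F "\<epsilon> / exp (\<bar>L\<bar> * T)"] v norm_n \<open>finite F\<close> \<epsilon>
    by (auto simp: solution_def)
  obtain w where w: "solution w" "w 0 = q"
    using solution_exists[OF q(1)] by blast
  have close: "norm (w t - v t) < \<epsilon>" if "\<bar>t\<bar> \<le> T" for t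
  proof -
    have "norm (w t - v t) \<le> exp (L * \<bar>t\<bar>) * norm (q - v 0)"
      using solution_norm_diff_le[OF w(1) v(1), of t] w(2) by simp
    also have "\<dots> \<le> exp (\<bar>L\<bar> * T) * norm (q - v 0)"
      using that by (intro mult_right_mono) (auto intro!: mult_mono)
    also have "\<dots> < \<epsilon>"
      using q(4) by (simp add: field_simps)
    finally show ?thesis .
  qed
  have close_h: "\<bar>w t \<bullet> n - ?h t\<bar> < \<epsilon>" if "\<bar>t\<bar> \<le> T" for t
    using Cauchy_Schwarz_ineq2[of "w t - v t" n] close[OF that] norm_n by (simp add: inner_diff_left)
  have sgn: "(w a \<bullet> n) * (w b \<bullet> n) < 0"
    using close_h[of a] close_h[of b] ab unfolding \<epsilon>_def mult_less_0_iff by auto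
  have "continuous_on {a..b} (\<lambda>t. w t \<bullet> n)"
    by (intro continuous_intros solution_continuous w)
  then obtain s where s: "a \<le> s" "s \<le> b" "w s \<bullet> n = 0"
    using sgn ab IVT'[of "\<lambda>t. w t \<bullet> n" a 0 b] IVT2'[of "\<lambda>t. w t \<bullet> n" b 0 a]
    unfolding mult_less_0_iff by fastforce
  have w_per: "w (t + 2 * s) = w t" for t
    using solution_periodic[OF w(1), of 0 s] w(2) q(2) s by simp
  have "\<not> w constant_on UNIV"
    using sgn unfolding constant_on_def mult_less_0_iff by force
  then have "periodic_orbit X (range w)"
    using w(1) w_per s ab unfolding periodic_orbit_def solution_def
    by (intro exI[of _ w] exI[of _ "2 * s"]) auto
  moreover have "range w \<subseteq> O' \<inter> sphere 0 1"
  proof -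
    have "w t \<in> O'" if "\<bar>t\<bar> \<le> T" for t
      using close[OF that] e by (force simp: \<epsilon>_def dist_norm norm_minus_commute)
    \<comment> \<open>The period interval is centred at 0 so that it lies within
      \<open>{- T..T}\<close>, where \<open>w\<close> is known to be close to
      \<open>v\<close>.\<close>
    moreover have "range w = w ` {- s..- s + 2 * s}"
      by (rule periodic_range_eq) (use w_per s ab in auto)
    ultimately show ?thesis
      using w(1) s ab by (auto simp: solution_def)
  qed
  ultimately have "range w = range v"
    using isolated range by metis
  then show False
    using F[of q] q w by (metis rangeI)
qed

section \<open>Quadratic fields as cross products\<close>

definition cross_field :: "real^3^3 \<Rightarrow> real^3 \<Rightarrow> real^3" where
  "cross_field M v = cross3 v (M *v v)"

lemma mat_mult_vector: "mat c *v v = c *\<^sub>R v" for v :: "real^'n"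
  by (simp add: vec_eq_iff matrix_vector_mult_def mat_def if_distrib if_distribR cong: if_cong)

text \<open>A vector has zero cross product with its own multiples; this permits moving any chosen
  eigenvalue of \<open>M\<close> to 0.\<close>

lemma cross_field_diff_scalar: "cross_field (M - mat c) = cross_field M"
  by (simp add: fun_eq_iff cross_field_def matrix_vector_mult_diff_rdistrib Cross3.right_diff_distrib
      mat_mult_vector cross_mult_right)

text \<open>Rotations preserve cross products, whereas an orthogonal matrix of determinant -1 would
  introduce a sign.\<close>

lemma cross_field_rotate:
  assumes "rotation_matrix A"
  shows "A *v cross_field M v = cross_field (A ** M ** transpose A) (A *v v)"
proof -
  have "transpose A ** A = mat 1"
    using assms by (simp add: rotation_matrix_def orthogonal_matrix_def)
  then have "(A ** M ** transpose A) *v (A *v v) = A *v (M *v v)"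
    by (metis matrix_mul_assoc matrix_mul_rid matrix_vector_mul_assoc)
  then show ?thesis
    by (simp add: cross_field_def cross_rotation_matrix[OF assms])
qed

lemma norm_cross3_le: "norm (cross3 v w) \<le> norm v * norm w"
proof (rule power2_le_imp_le)
  show "(norm (cross3 v w))\<^sup>2 \<le> (norm v * norm w)\<^sup>2"
    using norm_cross_dot[of v w] zero_le_power2[of "v \<bullet> w"] by linarith
qed simp

lemma cross_field_sphere_flow:
  obtains L where "sphere_flow (cross_field M) L"
proof -
  obtain B where B: "\<And>v. norm (M *v v) \<le> norm v * B" "B \<ge> 0"
    using bounded_linear.nonneg_bounded[OF matrix_vector_mul_bounded_linear[of M]] by blast
  have "norm (cross_field M v - cross_field M w) \<le> (2 * B) * norm (v - w)"
    if "v \<in> cball 0 1" "w \<in> cball 0 1" for v w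
  proof -
    have "cross_field M v - cross_field M w = cross3 (v - w) (M *v v) + cross3 w (M *v (v - w))"
      by (simp add: cross_field_def matrix_vector_mult_diff_distrib Cross3.left_diff_distrib Cross3.right_diff_distrib)
    also have "norm \<dots> \<le> norm (v - w) * norm (M *v v) + norm w * norm (M *v (v - w))"
      by (rule norm_triangle_le) (intro add_mono norm_cross3_le)
    also have "\<dots> \<le> norm (v - w) * (1 * B) + 1 * (norm (v - w) * B)"
      using that B by (intro add_mono mult_mono order_trans[OF B(1)] mult_right_mono) auto
    finally show ?thesis by (simp add: algebra_simps)
  qed
  then show thesis
    by (intro that sphere_flow.intro) (auto simp: cross_field_def dot_cross_self)
qed

lemma homogeneous_quadratic_poly3_coeffs:
  assumes "homogeneous_poly3 2 f"
  obtains a b c d e g where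
    "\<And>v. f v = a * (v$1)\<^sup>2 + b * (v$2)\<^sup>2 + c * (v$3)\<^sup>2 + d * (v$1) * (v$2) + e * (v$1) * (v$3) + g * (v$2) * (v$3)"
proof -
  obtain C where C: "\<And>v. f v = (\<Sum>i\<le>2. \<Sum>j\<le>2 - i. C i j * (v $ 1) ^ i * (v $ 2) ^ j * (v $ 3) ^ (2 - i - j))"
    using assms unfolding homogeneous_poly3_def by blast
  show thesis
    by (rule that[of "C 2 0" "C 0 2" "C 0 0" "C 1 1" "C 1 0" "C 0 1"])
      (simp add: C numeral_2_eq_2 algebra_simps)
qed

text \<open>The cubic form \<open>F\<close> vanishes on the sphere, hence everywhere by homogeneity.
  Its ten coefficients give ten linear relations among the eighteen of the field, leaving eight
  parameters: a 3x3 matrix modulo scalars.\<close>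

lemma homogeneous_quadratic_field_eq_cross_field:
  assumes "homogeneous_poly_vector_field 2 X"
  obtains M where "X = cross_field M"
proof -
  have hom: "homogeneous_poly3 2 (\<lambda>v. X v $ i)" for i
    using assms by (simp add: homogeneous_poly_vector_field_def)
  obtain a1 b1 c1 d1 e1 g1 where X1:
    "\<And>v. X v $ 1 = a1 * (v$1)\<^sup>2 + b1 * (v$2)\<^sup>2 + c1 * (v$3)\<^sup>2 + d1 * (v$1) * (v$2) + e1 * (v$1) * (v$3) + g1 * (v$2) * (v$3)"
    using homogeneous_quadratic_poly3_coeffs[OF hom[of 1]] by blast
  obtain a2 b2 c2 d2 e2 g2 where X2:
    "\<And>v. X v $ 2 = a2 * (v$1)\<^sup>2 + b2 * (v$2)\<^sup>2 + c2 * (v$3)\<^sup>2 + d2 * (v$1) * (v$2) + e2 * (v$1) * (v$3) + g2 * (v$2) * (v$3)"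
    using homogeneous_quadratic_poly3_coeffs[OF hom[of 2]] by blast
  obtain a3 b3 c3 d3 e3 g3 where X3:
    "\<And>v. X v $ 3 = a3 * (v$1)\<^sup>2 + b3 * (v$2)\<^sup>2 + c3 * (v$3)\<^sup>2 + d3 * (v$1) * (v$2) + e3 * (v$1) * (v$3) + g3 * (v$2) * (v$3)"
    using homogeneous_quadratic_poly3_coeffs[OF hom[of 3]] by blast
  define F where "F = (\<lambda>v. v $ 1 * X v $ 1 + v $ 2 * X v $ 2 + v $ 3 * X v $ 3)"
  have F_scale: "F (k *\<^sub>R v) = k ^ 3 * F v" for k v
    unfolding F_def X1 X2 X3 by (simp add: algebra_simps power2_eq_square power3_eq_cube)
  have F: "F v = 0" for v
  proof (cases "v = 0")
    case True
    then show ?thesis using F_scale[of 0 v] by simp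
  next
    case False
    then have "v /\<^sub>R norm v \<in> sphere 0 1" by simp
    then have "F (v /\<^sub>R norm v) = 0"
      using assms unfolding homogeneous_poly_vector_field_def F_def by blast
    then show ?thesis
      using F_scale[of "norm v" "v /\<^sub>R norm v"] False by simp
  qed
  note F' = F[of "vector [x, y, z]" for x y z, unfolded F_def X1 X2 X3 vector_3]
  have cubes: "a1 = 0" "b2 = 0" "c3 = 0"
    using F'[of 1 0 0] F'[of 0 1 0] F'[of 0 0 1] by simp_all
  have squares: "a2 = - d1" "d2 = - b1" "a3 = - e1" "e3 = - c1" "b3 = - g2" "g3 = - c2"
    using F'[of 1 1 0] F'[of 1 "- 1" 0] F'[of 1 0 1] F'[of 1 0 "- 1"]
      F'[of 0 1 1] F'[of 0 1 "- 1"] by (simp_all add: cubes)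
  have xyz: "d3 = - g1 - e2"
    using F'[of 1 1 1] by (simp add: cubes squares)
  \<comment> \<open>The freedom to add a scalar matrix is spent on making the last diagonal entry
    0.\<close>
  have "X v = cross_field (vector [vector [e2, g2, c2], vector [- e1, - g1, - c1],
      vector [d1, b1, 0]]) v" for v
    unfolding vec_eq_iff forall_3 X1 X2 X3 cubes squares xyz
    by (simp add: cross_field_def cross3_def matrix_vector_mult_def sum_3 algebra_simps power2_eq_square)
  then show thesis using that by blast
qed

section \<open>Limit cycles under orthogonal maps and reflections\<close>

lemma periodic_orbit_conjugate:
  assumes T: "orthogonal_transformation T" and XY: "\<And>v. T (X v) = Y (T v)"
    and "periodic_orbit X \<gamma>"
  shows "periodic_orbit Y (T ` \<gamma>)"
proof -
  obtain u p where u: "\<And>t. (u has_vector_derivative X (u t)) (at t)" "range u \<subseteq> sphere 0 1"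
    "p > 0" "\<And>t. u (t + p) = u t" "\<not> u constant_on UNIV" "\<gamma> = range u"
    using assms(3) unfolding periodic_orbit_def by blast
  have "bounded_linear T"
    using T by (simp add: orthogonal_transformation_linear linear_conv_bounded_linear[symmetric])
  then have "((\<lambda>t. T (u t)) has_vector_derivative Y (T (u t))) (at t)" for t
    using bounded_linear.has_vector_derivative[OF _ u(1)] by (metis XY)
  moreover have "\<not> (\<lambda>t. T (u t)) constant_on UNIV"
    using u(5) orthogonal_transformation_inj[OF T] unfolding constant_on_def by (metis injD)
  ultimately show ?thesis
    using u T unfolding periodic_orbit_def
    by (intro exI[of _ "\<lambda>t. T (u t)"] exI[of _ p]) (auto simp: orthogonal_transformation_norm image_image)
qed

lemma limit_cycle_conjugate:
  assumes T: "orthogonal_transformation T" and XY: "\<And>v. T (X v) = Y (T v)"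
    and "limit_cycle X \<gamma>"
  shows "limit_cycle Y (T ` \<gamma>)"
proof -
  obtain U where U: "openin (top_of_set (sphere 0 1)) U" "\<gamma> \<subseteq> U"
    "\<And>\<gamma>'. periodic_orbit X \<gamma>' \<Longrightarrow> \<gamma>' \<subseteq> U \<Longrightarrow> \<gamma>' = \<gamma>" and \<gamma>: "periodic_orbit X \<gamma>"
    using assms(3) unfolding limit_cycle_def by blast
  obtain O' where O': "open O'" "U = sphere 0 1 \<inter> O'"
    using U(1) by (auto simp: openin_open)
  have bij: "bij T" by (rule orthogonal_transformation_bij[OF T])
  have "T ` sphere 0 1 = sphere 0 1"
  proof
    show "sphere 0 1 \<subseteq> T ` sphere 0 1"
      using orthogonal_transformation_surj[OF T] orthogonal_transformation_norm[OF T]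
      by (force simp: surj_def)
  qed (auto simp: orthogonal_transformation_norm[OF T])
  then have "T ` U = sphere 0 1 \<inter> T ` O'"
    using bij O' by (simp add: image_Int bij_is_inj)
  moreover have "open (T ` O')"
    using O' T bij by (simp add: open_bijective_linear_image_eq orthogonal_transformation_linear)
  ultimately have "openin (top_of_set (sphere 0 1)) (T ` U)"
    by (auto simp: openin_open)
  moreover have "\<gamma>' = T ` \<gamma>" if "periodic_orbit Y \<gamma>'" "\<gamma>' \<subseteq> T ` U" for \<gamma>'
  proof -
    have "inv T (Y v) = X (inv T v)" for v
      using XY[of "inv T v"] bij by (metis bij_inv_eq_iff)
    then have "periodic_orbit X (inv T ` \<gamma>')"
      using periodic_orbit_conjugate[OF orthogonal_transformation_inv[OF T] _ that(1)] by blast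
    moreover have "inv T ` \<gamma>' \<subseteq> U"
      using that(2) bij by (force simp: bij_is_inj inv_f_f)
    ultimately have "inv T ` \<gamma>' = \<gamma>" by (rule U(3))
    then show ?thesis
      using bij by (metis bij_is_surj image_f_inv_f)
  qed
  ultimately show ?thesis
    using periodic_orbit_conjugate[OF T XY \<gamma>] U(2) unfolding limit_cycle_def
    by (intro conjI exI[of _ "T ` U"]) auto
qed

text \<open>A reflection has determinant -1, so it preserves cross products up to sign. The identity
  \<open>*\<close> expresses \<open>cross3 v w\<close> through the terms that arise when both sides
  are expanded.\<close>

lemma cross_reflect:
  assumes "norm n = 1"
  shows "cross3 (reflect n v) (reflect n w) = - reflect n (cross3 v w)"
proof -
  have "(n \<bullet> n) *\<^sub>R cross3 v w - (w \<bullet> n) *\<^sub>R cross3 v n - (v \<bullet> n) *\<^sub>R cross3 n w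
      = (cross3 v w \<bullet> n) *\<^sub>R n"
    by (simp add: cross3_simps forall_3)
  then have *: "cross3 v w = (w \<bullet> n) *\<^sub>R cross3 v n + (v \<bullet> n) *\<^sub>R cross3 n w + (cross3 v w \<bullet> n) *\<^sub>R n"
    using assms by (simp add: norm_eq_1 algebra_simps)
  have "cross3 (reflect n v) (reflect n w) + reflect n (cross3 v w)
      = 2 *\<^sub>R (cross3 v w - ((w \<bullet> n) *\<^sub>R cross3 v n + (v \<bullet> n) *\<^sub>R cross3 n w + (cross3 v w \<bullet> n) *\<^sub>R n))"
    by (simp add: reflect_def Cross3.left_diff_distrib Cross3.right_diff_distrib cross_mult_left cross_mult_right
        scaleR_2 algebra_simps)
  then show ?thesis
    unfolding *[symmetric] by (simp add: eq_neg_iff_add_eq_0)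
qed

text \<open>Being a right and a left eigenvector for the same eigenvalue, \<open>n\<close> makes
  \<open>M\<close> commute with \<open>reflect n\<close>; the sign comes from the cross
  product.\<close>

lemma cross_field_reversible:
  assumes n: "norm n = 1" and right: "M *v n = c *\<^sub>R n" and left: "\<And>v. (M *v v) \<bullet> n = c * (v \<bullet> n)"
  obtains L where "reversible_sphere_flow (cross_field M) L n"
proof -
  obtain L where L: "sphere_flow (cross_field M) L"
    by (rule cross_field_sphere_flow)
  have "M *v reflect n v = reflect n (M *v v)" for v
    by (simp add: reflect_def left right matrix_vector_mult_diff_distrib matrix_vector_mult_scaleR)
  then have "cross_field M (reflect n v) = - reflect n (cross_field M v)" for v
    by (simp add: cross_field_def cross_reflect[OF n])
  then show thesis
    using that L n by (simp add: reversible_sphere_flow_def reversible_sphere_flow_axioms_def)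
qed

lemma limit_cycle_solution:
  assumes "limit_cycle X \<gamma>" and flow: "sphere_flow X L"
  obtains u T where "sphere_flow.solution X u" "T > 0" "\<And>t. u (t + T) = u t"
    "\<not> u constant_on UNIV" "\<gamma> = range u" "\<And>t. X (u t) \<noteq> 0"
proof -
  interpret sphere_flow X L by fact
  obtain u T where u: "\<And>t. (u has_vector_derivative X (u t)) (at t)" "range u \<subseteq> sphere 0 1"
    "T > 0" "\<And>t. u (t + T) = u t" "\<not> u constant_on UNIV" "\<gamma> = range u"
    using assms(1) unfolding limit_cycle_def periodic_orbit_def by blast
  have "solution u"
    using u(1,2) by (auto simp: solution_def image_subset_iff)
  then show thesis
    using that u not_constant_on_range[OF \<open>solution u\<close> u(5)] by blast
qed

section \<open>An eigenvector on the third axis\<close>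

text \<open>The zero third column says that the third axis is an eigenvector with eigenvalue 0;
  \<open>p\<close>, \<open>q\<close>, \<open>r\<close>, \<open>s\<close> form the planar block, and
  \<open>c\<close>, \<open>d\<close> couple it to the third coordinate.\<close>

definition pole_matrix :: "real \<Rightarrow> real \<Rightarrow> real \<Rightarrow> real \<Rightarrow> real \<Rightarrow> real \<Rightarrow> real^3^3" where
  "pole_matrix p q r s c d = vector [vector [p, q, 0], vector [r, s, 0], vector [c, d, 0]]"

lemma pole_matrix_mult:
  "(pole_matrix p q r s c d *v v) $ 1 = p * v $ 1 + q * v $ 2"
  "(pole_matrix p q r s c d *v v) $ 2 = r * v $ 1 + s * v $ 2"
  "(pole_matrix p q r s c d *v v) $ 3 = c * v $ 1 + d * v $ 2"
  by (simp_all add: pole_matrix_def matrix_vector_mult_def sum_3)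

lemma cross_field_pole_matrix:
  fixes v :: "real^3"
  defines "x \<equiv> v $ 1" and "y \<equiv> v $ 2" and "z \<equiv> v $ 3"
  shows "cross_field (pole_matrix p q r s c d) v $ 1 = y * (c * x + d * y) - z * (r * x + s * y)"
    "cross_field (pole_matrix p q r s c d) v $ 2 = z * (p * x + q * y) - x * (c * x + d * y)"
    "cross_field (pole_matrix p q r s c d) v $ 3 = x * (r * x + s * y) - y * (p * x + q * y)"
  unfolding cross_field_def cross3_def vector_3 pole_matrix_mult x_def y_def z_def by simp_all

lemma exists_eigenvector_of_det_zero:
  fixes A :: "real^'n^'n"
  assumes "det A = 0"
  obtains v where "norm v = 1" "A *v v = 0"
proof -
  have "\<not> invertible A" using assms by (simp add: invertible_det_nz)
  then obtain v where v: "A *v v = 0" "v \<noteq> 0"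
    unfolding invertible_left_inverse matrix_left_invertible_ker by blast
  show thesis
    by (rule that[of "v /\<^sub>R norm v"]) (use v in \<open>auto simp: matrix_vector_mult_scaleR\<close>)
qed

lemma real_cubic_root:
  fixes a b c :: real
  obtains t where "t ^ 3 + a * t\<^sup>2 + b * t + c = 0"
proof -
  \<comment> \<open>At \<open>K\<close> and \<open>- K\<close> the cubic term outweighs the rest, so
    the polynomial has opposite signs there, up to zero.\<close>
  define K where "K = 1 + \<bar>a\<bar> + \<bar>b\<bar> + \<bar>c\<bar>"
  let ?f = "\<lambda>t. t ^ 3 + a * t\<^sup>2 + b * t + c"
  have K: "K \<ge> 1" by (simp add: K_def)
  have 1: "K \<le> K\<^sup>2" "1 \<le> K\<^sup>2"
    using K self_le_power[of K 2] one_le_power[of K 2] by auto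
  have "\<bar>a * K\<^sup>2\<bar> + \<bar>b * K\<bar> + \<bar>c\<bar> \<le> \<bar>a\<bar> * K\<^sup>2 + \<bar>b\<bar> * K\<^sup>2 + \<bar>c\<bar> * K\<^sup>2"
    using K 1 by (intro add_mono) (auto simp: abs_mult mult_left_mono mult_le_cancel_left1)
  also have "\<dots> = K ^ 3 - K\<^sup>2"
    by (simp add: K_def power3_eq_cube power2_eq_square algebra_simps)
  also have "\<dots> < K ^ 3" using K by simp
  finally have "?f (- K) \<le> 0" "0 \<le> ?f K"
    by auto
  moreover have "continuous_on {- K..K} ?f"
    by (intro continuous_intros)
  ultimately show thesis
    using IVT'[of ?f "- K" 0 K] K that by auto
qed

text \<open>The chosen root is a real root whose complementary quadratic factor has no two distinct real
  roots, or else the middle one of three distinct real roots.\<close>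
lemma real_cubic_middle_root:
  fixes a b c :: real
  obtains \<nu> \<tau> \<delta> where "\<And>t. t ^ 3 + a * t\<^sup>2 + b * t + c = (t - \<nu>) * (t\<^sup>2 - \<tau> * t + \<delta>)"
    "\<tau>\<^sup>2 \<le> 4 * \<delta> \<or> \<nu>\<^sup>2 - \<tau> * \<nu> + \<delta> < 0"
proof -
  obtain \<mu> where \<mu>: "\<mu> ^ 3 + a * \<mu>\<^sup>2 + b * \<mu> + c = 0"
    by (rule real_cubic_root)
  define \<tau> where "\<tau> = - (a + \<mu>)"
  define \<delta> where "\<delta> = b + \<mu> * (a + \<mu>)"
  have c: "c = - \<mu> * \<delta>"
    using \<mu> by (simp add: \<delta>_def power3_eq_cube power2_eq_square algebra_simps)
  have fac: "t ^ 3 + a * t\<^sup>2 + b * t + c = (t - \<mu>) * (t\<^sup>2 - \<tau> * t + \<delta>)" for t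
    unfolding c by (simp add: \<tau>_def \<delta>_def power3_eq_cube power2_eq_square algebra_simps)
  show thesis
  proof (cases "\<tau>\<^sup>2 \<le> 4 * \<delta>")
    case True
    then show thesis using that fac by blast
  next
    case False
    define e where "e = sqrt (\<tau>\<^sup>2 - 4 * \<delta>)"
    define l1 where "l1 = (\<tau> - e) / 2"
    define l2 where "l2 = (\<tau> + e) / 2"
    have e: "e > 0" "e\<^sup>2 = \<tau>\<^sup>2 - 4 * \<delta>" using False by (simp_all add: e_def)
    have l: "l1 < l2" "l1 + l2 = \<tau>" using e by (simp_all add: l1_def l2_def field_simps)
    have "l1 * l2 = \<delta>"
      using e(2) by (simp add: l1_def l2_def power2_eq_square field_simps)
    then have fac': "t ^ 3 + a * t\<^sup>2 + b * t + c = (t - \<mu>) * (t - l1) * (t - l2)" for t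
      unfolding fac l(2)[symmetric] by (simp add: power2_eq_square algebra_simps)
    note result = that
    \<comment> \<open>Here \<open>x\<close> is the root to be singled out: the simple root if the
      other two coincide, and otherwise the middle one.\<close>
    have choose: thesis
      if "\<And>t. (t - \<mu>) * (t - l1) * (t - l2) = (t - x) * (t - y) * (t - z)"
        "y = z \<or> (x - y) * (x - z) < 0" for x y z
    proof (rule result[of x "y + z" "y * z"])
      show "t ^ 3 + a * t\<^sup>2 + b * t + c = (t - x) * (t\<^sup>2 - (y + z) * t + y * z)" for t
        unfolding fac' that(1) by (simp add: power2_eq_square algebra_simps)
      have "x\<^sup>2 - (y + z) * x + y * z = (x - y) * (x - z)"
        by (simp add: power2_eq_square algebra_simps)
      then show "(y + z)\<^sup>2 \<le> 4 * (y * z) \<or> x\<^sup>2 - (y + z) * x + y * z < 0"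
        using that(2) by (auto simp: power2_eq_square)
    qed
    consider "\<mu> < l1" | "\<mu> = l1" | "l1 < \<mu> \<and> \<mu> < l2" | "\<mu> = l2" | "\<mu> > l2" by linarith
    then show thesis
    proof cases
      case 1
      then show thesis using l by (intro choose[of l1 \<mu> l2]) (auto intro: mult_pos_neg)
    next
      case 2
      then show thesis using l by (intro choose[of l2 \<mu> l1]) auto
    next
      case 3
      then show thesis using l by (intro choose[of \<mu> l1 l2]) (auto intro: mult_pos_neg)
    next
      case 4
      then show thesis using l by (intro choose[of l1 \<mu> l2]) auto
    next
      case 5
      then show thesis using l by (intro choose[of l2 l1 \<mu>]) (auto intro: mult_pos_neg)
    qed
  qed
qed

lemma rotation_to_axis:
  fixes e :: "real^3"
  assumes "norm e = 1"
  obtains A where "rotation_matrix A" "transpose A *v axis 3 1 = e"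
proof -
  obtain B where B: "rotation_matrix B" "B *v axis 3 1 = e"
    using rotation_matrix_exists_basis[of e 3] assms by auto
  then show thesis
    using that[of "transpose B"] by (simp add: rotation_matrix_def orthogonal_matrix_transpose)
qed

lemma charpoly_3:
  fixes M :: "real^3^3"
  shows "det (mat t - M) = t ^ 3 + (- (M$1$1 + M$2$2 + M$3$3)) * t\<^sup>2
    + (M$1$1 * M$2$2 - M$1$2 * M$2$1 + M$1$1 * M$3$3 - M$1$3 * M$3$1 + M$2$2 * M$3$3 - M$2$3 * M$3$2) * t
    + (- det M)"
  by (simp add: det_3 mat_def power3_eq_cube power2_eq_square algebra_simps)

text \<open>After the eigenvector of the chosen root \<nu> is rotated to the third axis and \<nu> is
  subtracted, the planar block has the complementary quadratic factor, shifted by \<nu>, as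
  characteristic polynomial. Its discriminant and determinant are then the two quantities controlled
  by the choice of root.\<close>

lemma cross_field_normal_form:
  fixes M :: "real^3^3"
  obtains A p q r s c d where "rotation_matrix A"
    "\<And>v. A *v cross_field M v = cross_field (pole_matrix p q r s c d) (A *v v)"
    "(p - s)\<^sup>2 + 4 * q * r \<le> 0 \<or> p * s - q * r < 0"
proof -
  obtain \<nu> \<tau> \<delta> where fac: "\<And>t. det (mat t - M) = (t - \<nu>) * (t\<^sup>2 - \<tau> * t + \<delta>)"
    and choice: "\<tau>\<^sup>2 \<le> 4 * \<delta> \<or> \<nu>\<^sup>2 - \<tau> * \<nu> + \<delta> < 0"
    unfolding charpoly_3 using real_cubic_middle_root by metis
  obtain e where e: "norm e = 1" "(mat \<nu> - M) *v e = 0"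
    using exists_eigenvector_of_det_zero[of "mat \<nu> - M"] fac[of \<nu>] by auto
  obtain A where A: "rotation_matrix A" "transpose A *v axis 3 1 = e"
    by (rule rotation_to_axis[OF e(1)])
  have AA: "A ** transpose A = mat 1" and det: "det A = 1"
    using A(1) by (simp_all add: rotation_matrix_def orthogonal_matrix_def)
  define N where "N = A ** (M - mat \<nu>) ** transpose A"
  have "(M - mat \<nu>) *v e = 0"
    using e(2) by (simp add: matrix_vector_mult_diff_rdistrib)
  then have "N *v axis 3 1 = 0"
    by (simp only: N_def matrix_vector_mul_assoc[symmetric] A(2) matrix_vector_mult_0_right)
  then have col: "N $ i $ 3 = 0" for i
    by (simp add: matrix_vector_mul_component inner_axis vec_eq_iff)
  have N: "N = pole_matrix (N$1$1) (N$1$2) (N$2$1) (N$2$2) (N$3$1) (N$3$2)"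
    by (simp add: pole_matrix_def vec_eq_iff forall_3 col)
  have "det (mat t - N) = det (mat (t + \<nu>) - M)" for t
  proof -
    have "mat t - N = A ** (mat (t + \<nu>) - M) ** transpose A"
    proof -
      have "A *v (transpose A *v x) = x" for x
        by (metis AA matrix_vector_mul_assoc matrix_vector_mul_lid)
      then show ?thesis
        by (simp add: matrix_eq N_def matrix_vector_mul_assoc[symmetric] matrix_vector_mult_diff_rdistrib
            matrix_vector_mult_diff_distrib matrix_vector_mult_scaleR mat_mult_vector scaleR_left_distrib
            matrix_vector_right_distrib
            del: transpose_matrix_vector)
    qed
    then show ?thesis by (simp add: det_mul det)
  qed
  moreover have detN: "det N = 0"
    by (simp add: det_3 col)
  ultimately have "t * ((t + \<nu>)\<^sup>2 - \<tau> * (t + \<nu>) + \<delta>)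
      = t ^ 3 + (- (N$1$1 + N$2$2)) * t\<^sup>2 + (N$1$1 * N$2$2 - N$1$2 * N$2$1) * t" for t
    using charpoly_3[of t N] by (simp add: fac col detN)
  \<comment> \<open>Both sides are cubics in \<open>t\<close> with equal leading and constant terms,
    so two values fix the trace and the determinant of the block.\<close>
  from this[of 1] this[of "- 1"]
  have tr: "N$1$1 + N$2$2 = \<tau> - 2 * \<nu>"
    and dt: "N$1$1 * N$2$2 - N$1$2 * N$2$1 = \<nu>\<^sup>2 - \<tau> * \<nu> + \<delta>"
    by (simp_all add: power2_eq_square algebra_simps)
  have "(N$1$1 - N$2$2)\<^sup>2 + 4 * N$1$2 * N$2$1
      = (N$1$1 + N$2$2)\<^sup>2 - 4 * (N$1$1 * N$2$2 - N$1$2 * N$2$1)"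
    by (simp add: power2_eq_square algebra_simps)
  also have "\<dots> = \<tau>\<^sup>2 - 4 * \<delta>"
    unfolding tr dt by (simp add: power2_eq_square algebra_simps)
  finally have "(N$1$1 - N$2$2)\<^sup>2 + 4 * N$1$2 * N$2$1 \<le> 0 \<or> N$1$1 * N$2$2 - N$1$2 * N$2$1 < 0"
    using choice dt by auto
  moreover have "A *v cross_field M v = cross_field N (A *v v)" for v
    using cross_field_rotate[OF A(1), of "M - mat \<nu>" v] by (simp add: N_def cross_field_diff_scalar)
  ultimately show thesis
    using that[OF A(1)] N by metis
qed

section \<open>Periodic scalar functions and semidefinite binary forms\<close>

lemma periodic_monotone_derivative_zero:
  fixes f :: "real \<Rightarrow> real"
  assumes f: "\<And>t. (f has_real_derivative f' t) (at t)" and T: "T > 0" "\<And>t. f (t + T) = f t"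
    and sign: "(\<forall>t. f' t \<ge> 0) \<or> (\<forall>t. f' t \<le> 0)"
  shows "f' t = 0"
proof -
  have "f t = f 0" for t
  proof -
    have *: "g t = g 0" if g: "\<And>t. (g has_real_derivative g' t) (at t)" "\<And>t. g' t \<ge> 0"
      "\<And>t. g (t + T) = g t" for g g'
    proof -
      have mono: "g x \<le> g y" if "x \<le> y" for x y
        using DERIV_nonneg_imp_nondecreasing[OF that] g by blast
      have "g t \<in> g ` {0..0 + T}"
        using periodic_range_eq[of T g 0] T(1) g(3) by blast
      then obtain s where "s \<in> {0..T}" "g t = g s" by auto
      then show ?thesis
        using mono[of 0 s] mono[of s T] g(3)[of 0] by simp
    qed
    from sign show ?thesis
    proof
      assume "\<forall>t. f' t \<ge> 0"
      then show ?thesis using *[of f f'] f T by blast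
    next
      assume "\<forall>t. f' t \<le> 0"
      then show ?thesis
        using *[of "\<lambda>t. - f t" "\<lambda>t. - f' t"] T by (auto intro!: DERIV_minus f)
    qed
  qed
  then have "f = (\<lambda>_. f 0)" by blast
  then have "(f has_real_derivative 0) (at t)" by (metis DERIV_const)
  then show ?thesis using f DERIV_unique by blast
qed

text \<open>Rolle's theorem on one period; applied to suitable functions along an orbit, it finds a
  time at which the orbit meets the mirror.\<close>

lemma periodic_critical_point:
  fixes f :: "real \<Rightarrow> real"
  assumes f: "\<And>t. (f has_real_derivative f' t) (at t)" and T: "T > 0" "\<And>t. f (t + T) = f t"
  obtains t where "f' t = 0"
proof -
  have "\<exists>z>0. z < T \<and> (f has_real_derivative 0) (at z)"
  proof (rule Rolle[OF T(1)])
    show "f 0 = f T" using T(2)[of 0] by simp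
    show "continuous_on {0..T} f"
      using f by (meson DERIV_isCont continuous_at_imp_continuous_on)
    show "f differentiable (at x)" for x
      using f real_differentiable_def by blast
  qed
  then show thesis using that f DERIV_unique by blast
qed

text \<open>Completing the square: at a zero of the form the square of
  \<open>2 * r * x + b * y\<close> is at most 0. If \<open>r = 0\<close>, then also
  \<open>b = 0\<close> and the form is a multiple of \<open>y\<^sup>2\<close>.\<close>

lemma semidefinite_form_zero_line:
  fixes r b q :: real
  assumes "b\<^sup>2 + 4 * r * q \<le> 0" "r \<noteq> 0 \<or> b \<noteq> 0 \<or> q \<noteq> 0"
  obtains \<alpha> \<beta> where "\<alpha> \<noteq> 0 \<or> \<beta> \<noteq> 0"
    "\<And>x y. r * x\<^sup>2 + b * x * y - q * y\<^sup>2 = 0 \<Longrightarrow> \<alpha> * x + \<beta> * y = 0"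
proof (cases "r = 0")
  case True
  then have "b = 0" using assms(1) by simp
  then show thesis using True assms(2) by (intro that[of 0 1]) auto
next
  case False
  show thesis
  proof (rule that[of "2 * r" b])
    fix x y assume 0: "r * x\<^sup>2 + b * x * y - q * y\<^sup>2 = 0"
    have "(2 * r * x + b * y)\<^sup>2
        = 4 * r * (r * x\<^sup>2 + b * x * y - q * y\<^sup>2) + (b\<^sup>2 + 4 * r * q) * y\<^sup>2"
      by (simp add: power2_eq_square algebra_simps)
    also have "\<dots> \<le> 0" using 0 assms(1) by (simp add: mult_nonpos_nonneg)
    finally show "2 * r * x + b * y = 0" by simp
  qed (use False in simp)
qed

lemma semidefinite_form_sign:
  fixes r b q :: real
  assumes "b\<^sup>2 + 4 * r * q \<le> 0"
  shows "(\<forall>x y. r * x\<^sup>2 + b * x * y - q * y\<^sup>2 \<ge> 0) \<or> (\<forall>x y. r * x\<^sup>2 + b * x * y - q * y\<^sup>2 \<le> 0)"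
proof -
  have "4 * r * (r * x\<^sup>2 + b * x * y - q * y\<^sup>2) = (2 * r * x + b * y)\<^sup>2 + (- (b\<^sup>2 + 4 * r * q)) * y\<^sup>2" for x y
    by (simp add: power2_eq_square algebra_simps)
  moreover have "0 \<le> (2 * r * x + b * y)\<^sup>2 + (- (b\<^sup>2 + 4 * r * q)) * y\<^sup>2" for x y
    by (intro add_nonneg_nonneg mult_nonneg_nonneg) (use assms in auto)
  ultimately have r: "0 \<le> 4 * r * (r * x\<^sup>2 + b * x * y - q * y\<^sup>2)" for x y
    by metis
  consider "r > 0" | "r < 0" | "r = 0" by linarith
  then show ?thesis
  proof cases
    case 1
    then show ?thesis using r by (simp add: zero_le_mult_iff)
  next
    case 2
    then show ?thesis using r by (simp add: zero_le_mult_iff)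
  next
    case 3
    then have "b = 0" using assms by simp
    then show ?thesis using 3 by (cases "q \<ge> 0") (auto simp: mult_nonpos_nonneg)
  qed
qed

section \<open>Degenerate cases and the two families\<close>

text \<open>If the planar block is scalar, the flow is reversible in a plane that the orbit meets.
  Otherwise the third coordinate is monotone, hence constant, along a periodic orbit, which confines
  the orbit to a plane through the third axis and forces an equilibrium.\<close>

lemma no_limit_cycle_if_semidefinite:
  assumes disc: "(p - s)\<^sup>2 + 4 * q * r \<le> 0"
  shows "\<not> limit_cycle (cross_field (pole_matrix p q r s c d)) \<gamma>"
proof
  let ?X = "cross_field (pole_matrix p q r s c d)"
  assume limit: "limit_cycle ?X \<gamma>"
  obtain L where L: "sphere_flow ?X L" by (rule cross_field_sphere_flow)
  interpret sphere_flow ?X L by fact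
  obtain u T where u: "solution u" "T > 0" "\<And>t. u (t + T) = u t" "\<not> u constant_on UNIV"
    "\<gamma> = range u" and X: "\<And>t. ?X (u t) \<noteq> 0"
    using limit_cycle_solution[OF limit L] by metis
  have X': "\<not> (?X (u t) $ 1 = 0 \<and> ?X (u t) $ 2 = 0 \<and> ?X (u t) $ 3 = 0)" for t
    using X[of t] by (auto simp: vec_eq_iff forall_3)
  have der: "((\<lambda>t. u t $ i) has_real_derivative ?X (u t) $ i) (at t)" for i t
    using solution_inner_derivative[OF u(1), of "axis i 1"] by (simp add: inner_axis)
  show False
  proof (cases "r = 0 \<and> q = 0 \<and> p = s")
    case True
    \<comment> \<open>Orthogonality to \<open>(c, d)\<close> makes the normal
      \<open>(\<alpha>, \<beta>, 0)\<close> a right eigenvector; it is a left one because the block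
      is scalar.\<close>
    obtain \<alpha> \<beta> where ab: "\<alpha>\<^sup>2 + \<beta>\<^sup>2 = 1" "c * \<alpha> + d * \<beta> = 0"
    proof (cases "c = 0 \<and> d = 0")
      case False
      then have pos: "c\<^sup>2 + d\<^sup>2 > 0" by (simp add: sum_power2_gt_zero_iff)
      show thesis
      proof (rule that[of "- d / sqrt (c\<^sup>2 + d\<^sup>2)" "c / sqrt (c\<^sup>2 + d\<^sup>2)"])
        show "(- d / sqrt (c\<^sup>2 + d\<^sup>2))\<^sup>2 + (c / sqrt (c\<^sup>2 + d\<^sup>2))\<^sup>2 = 1"
          using pos False by (simp add: power_divide add_divide_distrib[symmetric])
      qed simp
    qed (use that[of 1 0] in simp)
    define n :: "real^3" where "n = vector [\<alpha>, \<beta>, 0]"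
    have n: "norm n = 1"
      using ab by (simp add: n_def norm_eq_1 inner_vec_def sum_3 power2_eq_square)
    obtain K where K: "reversible_sphere_flow ?X K n"
    proof (rule cross_field_reversible[OF n])
      show "pole_matrix p q r s c d *v n = p *\<^sub>R n"
        using True ab by (simp add: vec_eq_iff forall_3 pole_matrix_mult n_def)
      show "(pole_matrix p q r s c d *v v) \<bullet> n = p * (v \<bullet> n)" for v
        using True by (simp add: inner_vec_def sum_3 pole_matrix_mult n_def algebra_simps)
    qed
    \<comment> \<open>With a scalar block the field is \<open>g\<close> times the rotation field
      \<open>(y, - x, 0)\<close>, so \<open>g\<close> cannot vanish on the orbit.\<close>
    define g where "g = (\<lambda>t. c * u t $ 1 + d * u t $ 2 - p * u t $ 3)"
    have comp: "?X (u t) $ 1 = u t $ 2 * g t" "?X (u t) $ 2 = - u t $ 1 * g t" "?X (u t) $ 3 = 0" for t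
      using True by (simp_all add: cross_field_pole_matrix g_def algebra_simps)
    then have g: "g t \<noteq> 0" for t using X' by fastforce
    have "((\<lambda>t. \<alpha> * u t $ 2 - \<beta> * u t $ 1) has_real_derivative
        \<alpha> * ?X (u t) $ 2 - \<beta> * ?X (u t) $ 1) (at t)" for t
      by (intro DERIV_diff DERIV_cmult der)
    moreover have "\<alpha> * ?X (u t) $ 2 - \<beta> * ?X (u t) $ 1 = - (u t \<bullet> n) * g t" for t
      unfolding comp by (simp add: n_def inner_vec_def sum_3 algebra_simps)
    ultimately have "((\<lambda>t. \<alpha> * u t $ 2 - \<beta> * u t $ 1) has_real_derivative - (u t \<bullet> n) * g t) (at t)" for t
      by metis
    then obtain t where "- (u t \<bullet> n) * g t = 0"
      by (rule periodic_critical_point[OF _ u(2)]) (simp_all add: u(3))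
    then have "u t \<bullet> n = 0" using g by simp
    then show False
      using reversible_not_limit_cycle[OF K u(1) u(4) u(2) u(3)] limit u(5) by blast
  next
    case False
    let ?q = "\<lambda>x y. r * x\<^sup>2 + (s - p) * x * y - q * y\<^sup>2"
    have disc': "(s - p)\<^sup>2 + 4 * r * q \<le> 0"
      using disc by (simp add: power2_commute mult.commute mult.left_commute)
    have X3: "?X (u t) $ 3 = ?q (u t $ 1) (u t $ 2)" for t
      by (simp add: cross_field_pole_matrix power2_eq_square algebra_simps)
    have zero: "?X (u t) $ 3 = 0" for t
    proof (rule periodic_monotone_derivative_zero[OF der u(2)])
      show "u (t + T) $ 3 = u t $ 3" for t by (simp add: u(3))
      show "(\<forall>t. 0 \<le> ?X (u t) $ 3) \<or> (\<forall>t. ?X (u t) $ 3 \<le> 0)"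
        unfolding X3 using semidefinite_form_sign[OF disc'] by blast
    qed
    obtain \<alpha> \<beta> where ab: "\<alpha> \<noteq> 0 \<or> \<beta> \<noteq> 0"
      "\<And>x y. ?q x y = 0 \<Longrightarrow> \<alpha> * x + \<beta> * y = 0"
      using semidefinite_form_zero_line[OF disc'] False by auto
    have line: "\<alpha> * u t $ 1 + \<beta> * u t $ 2 = 0" for t
      using ab(2) zero X3 by metis
    have "((\<lambda>t. \<alpha> * u t $ 1 + \<beta> * u t $ 2) has_real_derivative
        \<alpha> * ?X (u 0) $ 1 + \<beta> * ?X (u 0) $ 2) (at 0)"
      by (intro DERIV_add DERIV_cmult der)
    then have 1: "\<alpha> * ?X (u 0) $ 1 + \<beta> * ?X (u 0) $ 2 = 0"
      unfolding line using DERIV_unique DERIV_const by blast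
    have 2: "u 0 $ 1 * ?X (u 0) $ 1 + u 0 $ 2 * ?X (u 0) $ 2 = 0"
      using tangent[of "u 0"] zero by (simp add: inner_vec_def sum_3)
    have 3: "\<alpha> * u 0 $ 1 + \<beta> * u 0 $ 2 = 0" by (rule line)
    \<comment> \<open>The first two coordinates of the point and of the field are both orthogonal to
      \<open>(\<alpha>, \<beta>)\<close>, hence parallel, and also orthogonal to each other, so one
      pair vanishes. Either way the point is an equilibrium.\<close>
    have "(\<alpha>\<^sup>2 + \<beta>\<^sup>2) * (u 0 $ 1 * ?X (u 0) $ 1) = 0 \<and> (\<alpha>\<^sup>2 + \<beta>\<^sup>2) * (u 0 $ 2 * ?X (u 0) $ 2) = 0
      \<and> (\<alpha>\<^sup>2 + \<beta>\<^sup>2) * (u 0 $ 1 * ?X (u 0) $ 2) = 0 \<and> (\<alpha>\<^sup>2 + \<beta>\<^sup>2) * (u 0 $ 2 * ?X (u 0) $ 1) = 0"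
      using 1 2 3 by algebra
    moreover have "\<alpha>\<^sup>2 + \<beta>\<^sup>2 \<noteq> 0" using ab(1) by (simp add: sum_power2_eq_zero_iff)
    moreover have "u 0 $ 1 \<noteq> 0 \<or> u 0 $ 2 \<noteq> 0"
      using X'[of 0] by (auto simp: cross_field_pole_matrix)
    ultimately show False
      using X'[of 0] zero[of 0] by auto
  qed
qed

text \<open>The mirror is the plane of the first two axes, and a periodic orbit that avoided it
  would carry a strictly monotone function.\<close>

lemma no_limit_cycle_if_block_diagonal:
  assumes "p * s < 0"
  shows "\<not> limit_cycle (cross_field (pole_matrix p q 0 s 0 0)) \<gamma>"
proof
  let ?X = "cross_field (pole_matrix p q 0 s 0 0)"
  assume limit: "limit_cycle ?X \<gamma>"
  define n :: "real^3" where "n = axis 3 1"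
  have n: "norm n = 1" by (simp add: n_def)
  obtain K where K: "reversible_sphere_flow ?X K n"
  proof (rule cross_field_reversible[OF n])
    show "pole_matrix p q 0 s 0 0 *v n = 0 *\<^sub>R n"
      by (simp add: vec_eq_iff forall_3 pole_matrix_mult n_def axis_def)
    show "(pole_matrix p q 0 s 0 0 *v v) \<bullet> n = 0 * (v \<bullet> n)" for v
      by (simp add: inner_axis pole_matrix_mult n_def)
  qed
  interpret reversible_sphere_flow ?X K n by fact
  obtain u T where u: "solution u" "T > 0" "\<And>t. u (t + T) = u t" "\<not> u constant_on UNIV"
    "\<gamma> = range u" and X: "\<And>t. ?X (u t) \<noteq> 0"
    using limit_cycle_solution[OF limit sphere_flow_axioms] by metis
  have der: "((\<lambda>t. u t $ i) has_real_derivative ?X (u t) $ i) (at t)" for i t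
    using solution_inner_derivative[OF u(1), of "axis i 1"] by (simp add: inner_axis)
  \<comment> \<open>Off the mirror, the orbit follows the linear saddle \<open>x' = - s y, y' = p x + q y\<close> up to a change
    of time; along that saddle, \<open>Q\<close> is strictly monotone.\<close>
  define k where "k = sgn p * q"
  \<comment> \<open>This value cancels the mixed term in the derivative of \<open>Q\<close>.\<close>
  define l where "l = (q + 2 * k * p) / (2 * s)"
  define Q where "Q = (\<lambda>t. u t $ 1 * u t $ 2 + l * (u t $ 1)\<^sup>2 + k * (u t $ 2)\<^sup>2)"
  have s: "s \<noteq> 0" using assms by auto
  have "(Q has_real_derivative u t $ 3 * (p * (u t $ 1)\<^sup>2 + (2 * k * q - s) * (u t $ 2)\<^sup>2)) (at t)" for t
  proof -
    have l: "2 * s * l = q + 2 * k * p" using s by (simp add: l_def)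
    have "(Q has_real_derivative ?X (u t) $ 1 * u t $ 2 + u t $ 1 * ?X (u t) $ 2
        + l * (2 * u t $ 1 * ?X (u t) $ 1) + k * (2 * u t $ 2 * ?X (u t) $ 2)) (at t)"
      unfolding Q_def by (rule derivative_eq_intros der refl | simp)+
    also have "?X (u t) $ 1 * u t $ 2 + u t $ 1 * ?X (u t) $ 2
        + l * (2 * u t $ 1 * ?X (u t) $ 1) + k * (2 * u t $ 2 * ?X (u t) $ 2)
      = u t $ 3 * (p * (u t $ 1)\<^sup>2 + (2 * k * q - s) * (u t $ 2)\<^sup>2)
        + u t $ 1 * u t $ 2 * u t $ 3 * (q + 2 * k * p - 2 * s * l)"
      by (simp add: cross_field_pole_matrix power2_eq_square algebra_simps)
    finally show ?thesis by (simp add: l)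
  qed
  then obtain t where t: "u t $ 3 * (p * (u t $ 1)\<^sup>2 + (2 * k * q - s) * (u t $ 2)\<^sup>2) = 0"
    by (rule periodic_critical_point[OF _ u(2)]) (simp_all add: Q_def u(3))
  have "u t $ 3 = 0"
  proof (rule ccontr)
    assume "u t $ 3 \<noteq> 0"
    then have 0: "p * (u t $ 1)\<^sup>2 + (2 * k * q - s) * (u t $ 2)\<^sup>2 = 0" using t by simp
    \<comment> \<open>The choice of \<open>k\<close> gives \<open>k * q\<close> the sign of
      \<open>p\<close>, or 0, and \<open>s\<close> has the opposite sign; so both coefficients have
      the sign of \<open>p\<close> and the form is definite.\<close>
    have "u t $ 1 = 0 \<and> u t $ 2 = 0"
    proof (cases "p > 0")
      case True
      then have "s < 0" "k * q \<ge> 0"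
        using assms by (simp_all add: k_def mult_less_0_iff)
      then have "2 * k * q - s > 0" by linarith
      then show ?thesis
        using 0 True by (simp add: add_nonneg_eq_0_iff)
    next
      case False
      then have "p < 0" "s > 0" using assms by (auto simp: mult_less_0_iff)
      then have "k * q \<le> 0" by (simp add: k_def)
      then have "- p > 0" "s - 2 * k * q > 0"
        using \<open>p < 0\<close> \<open>s > 0\<close> by linarith+
      moreover have "(- p) * (u t $ 1)\<^sup>2 + (s - 2 * k * q) * (u t $ 2)\<^sup>2 = 0"
        using 0 by (simp add: algebra_simps)
      ultimately show ?thesis
        by (subst (asm) add_nonneg_eq_0_iff) (auto simp: mult_nonpos_nonneg)
    qed
    then have "?X (u t) = 0"
      by (simp add: vec_eq_iff forall_3 cross_field_pole_matrix)
    then show False using X by blast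
  qed
  then have "u t \<bullet> n = 0" by (simp add: n_def inner_axis)
  then show False
    using reversible_not_limit_cycle[OF K u(1) u(4) u(2) u(3)] limit u(5) by blast
qed

section \<open>Triangularizing the planar block and reading off the families\<close>

text \<open>Since the block minus \<open>l\<close> is singular, a vector orthogonal to a nonzero row
  of it lies in the kernel: \<open>(q, l - p)\<close> for the first row, \<open>(l - s, r)\<close>
  for the second. If both rows vanish, any vector serves.\<close>

lemma planar_eigenvector:
  fixes p q r s :: real
  assumes "l\<^sup>2 - (p + s) * l + (p * s - q * r) = 0"
  obtains x y where "x\<^sup>2 + y\<^sup>2 = 1" "p * x + q * y = l * x" "r * x + s * y = l * y"
proof -
  have det: "(p - l) * (s - l) - q * r = 0"
    using assms by (simp add: power2_eq_square algebra_simps)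
  note result = that
  have normalize: thesis if v: "x \<noteq> 0 \<or> y \<noteq> 0" "p * x + q * y = l * x" "r * x + s * y = l * y" for x y
  proof -
    have pos: "x\<^sup>2 + y\<^sup>2 > 0" using v(1) by (simp add: sum_power2_gt_zero_iff)
    show thesis
    proof (rule result[of "x / sqrt (x\<^sup>2 + y\<^sup>2)" "y / sqrt (x\<^sup>2 + y\<^sup>2)"])
      show "(x / sqrt (x\<^sup>2 + y\<^sup>2))\<^sup>2 + (y / sqrt (x\<^sup>2 + y\<^sup>2))\<^sup>2 = 1"
        using pos v(1) by (simp add: power_divide add_divide_distrib[symmetric])
    qed (use v in \<open>simp_all add: add_divide_distrib[symmetric]\<close>)
  qed
  show thesis
  proof (cases "q = 0 \<and> p = l")
    case True
    show thesis
    proof (cases "s - l = 0 \<and> r = 0")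
      case True
      then show ?thesis using \<open>q = 0 \<and> p = l\<close> by (intro normalize[of 1 0]) auto
    next
      case False
      then show ?thesis using True by (intro normalize[of "l - s" r]) (auto simp: algebra_simps)
    qed
  next
    case False
    then show ?thesis
      using det by (intro normalize[of q "l - p"]) (auto simp: algebra_simps)
  qed
qed

lemma real_roots_of_negative_product:
  fixes b e :: real
  assumes "e < 0"
  obtains l1 l2 where "l1 \<noteq> l2" "l1\<^sup>2 - b * l1 + e = 0" "l2\<^sup>2 - b * l2 + e = 0"
proof -
  define D where "D = sqrt (b\<^sup>2 - 4 * e)"
  have "b\<^sup>2 - 4 * e > 0"
    using assms zero_le_power2[of b] by linarith
  then have D: "D\<^sup>2 = b\<^sup>2 - 4 * e" and "D > 0"
    by (simp_all add: D_def)
  then have "((b + D) / 2)\<^sup>2 - b * ((b + D) / 2) + e = 0" "((b - D) / 2)\<^sup>2 - b * ((b - D) / 2) + e = 0"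
    by (simp_all add: power2_eq_square field_simps)
  then show thesis using \<open>D > 0\<close> that[of "(b + D) / 2" "(b - D) / 2"] by simp
qed

text \<open>The negative determinant yields two distinct real eigenvalues whose product is negative.
  Their eigenvectors are independent, so a nonzero \<open>(c, d)\<close> cannot be orthogonal to
  both.\<close>

lemma planar_saddle_eigenvector:
  fixes p q r s c d :: real
  assumes "p * s - q * r < 0"
  obtains l x y where "x\<^sup>2 + y\<^sup>2 = 1" "p * x + q * y = l * x" "r * x + s * y = l * y"
    "l * (p + s - l) < 0" "c * x + d * y \<noteq> 0 \<or> c = 0 \<and> d = 0"
proof -
  obtain l1 l2 where l: "l1 \<noteq> l2" "l1\<^sup>2 - (p + s) * l1 + (p * s - q * r) = 0"
    "l2\<^sup>2 - (p + s) * l2 + (p * s - q * r) = 0"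
    by (rule real_roots_of_negative_product[OF assms])
  obtain x1 y1 where v1: "x1\<^sup>2 + y1\<^sup>2 = 1" "p * x1 + q * y1 = l1 * x1" "r * x1 + s * y1 = l1 * y1"
    by (rule planar_eigenvector[OF l(2)])
  obtain x2 y2 where v2: "x2\<^sup>2 + y2\<^sup>2 = 1" "p * x2 + q * y2 = l2 * x2" "r * x2 + s * y2 = l2 * y2"
    by (rule planar_eigenvector[OF l(3)])
  have prod: "l1 * (p + s - l1) < 0" "l2 * (p + s - l2) < 0"
    using l(2,3) assms by (simp_all add: power2_eq_square algebra_simps)
  have "c = 0 \<and> d = 0" if "c * x1 + d * y1 = 0" "c * x2 + d * y2 = 0"
  proof -
    have "x1 * y2 - x2 * y1 \<noteq> 0"
    proof
      assume "x1 * y2 - x2 * y1 = 0"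
      then have "(l1 - l2) * (x1\<^sup>2 + y1\<^sup>2) * (x2\<^sup>2 + y2\<^sup>2) = 0"
        using v1(2,3) v2(2,3) by algebra
      then show False using l(1) v1(1) v2(1) by simp
    qed
    moreover have "c * (x1 * y2 - x2 * y1) = 0" "d * (x1 * y2 - x2 * y1) = 0"
      using that by algebra+
    ultimately show ?thesis by simp
  qed
  then show thesis
    using that[of x1 y1 l1] that[of x2 y2 l2] v1 v2 prod by blast
qed

text \<open>The rotation about the third axis that takes \<open>(x, y, 0)\<close> to the first axis;
  it keeps the third column zero.\<close>

lemma pole_matrix_rotate:
  assumes "x\<^sup>2 + y\<^sup>2 = 1"
  obtains B where "rotation_matrix B"
    "B ** pole_matrix p q r s c d ** transpose B = pole_matrix
       (x * (p * x + q * y) + y * (r * x + s * y)) (x * (q * x - p * y) + y * (s * x - r * y))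
       (x * (r * x + s * y) - y * (p * x + q * y)) (x * (s * x - r * y) - y * (q * x - p * y))
       (c * x + d * y) (d * x - c * y)"
proof
  let ?B = "vector [vector [x, y, 0], vector [- y, x, 0], vector [0, 0, 1]] :: real^3^3"
  show "rotation_matrix ?B"
    using assms by (simp add: rotation_matrix_def orthogonal_matrix vec_eq_iff forall_3
        matrix_matrix_mult_def sum_3 transpose_def mat_def det_3 power2_eq_square algebra_simps)
  show "?B ** pole_matrix p q r s c d ** transpose ?B = pole_matrix
       (x * (p * x + q * y) + y * (r * x + s * y)) (x * (q * x - p * y) + y * (s * x - r * y))
       (x * (r * x + s * y) - y * (p * x + q * y)) (x * (s * x - r * y) - y * (q * x - p * y))
       (c * x + d * y) (d * x - c * y)"
    by (simp add: pole_matrix_def vec_eq_iff forall_3 matrix_matrix_mult_def sum_3 transpose_def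
        algebra_simps)
qed

text \<open>With an eigenvector on the first axis the block is upper triangular, with its two
  eigenvalues on the diagonal.\<close>

lemma cross_field_saddle_normal_form:
  assumes "p * s - q * r < 0"
  obtains B p' q' s' c' d' where "rotation_matrix B"
    "\<And>v. B *v cross_field (pole_matrix p q r s c d) v = cross_field (pole_matrix p' q' 0 s' c' d') (B *v v)"
    "p' * s' < 0" "c' \<noteq> 0 \<or> c' = 0 \<and> d' = 0"
proof -
  obtain l x y where v: "x\<^sup>2 + y\<^sup>2 = 1" "p * x + q * y = l * x" "r * x + s * y = l * y"
    and l: "l * (p + s - l) < 0" and c: "c * x + d * y \<noteq> 0 \<or> c = 0 \<and> d = 0"
    by (rule planar_saddle_eigenvector[OF assms])
  obtain B where B: "rotation_matrix B"
    "B ** pole_matrix p q r s c d ** transpose B = pole_matrix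
       (x * (p * x + q * y) + y * (r * x + s * y)) (x * (q * x - p * y) + y * (s * x - r * y))
       (x * (r * x + s * y) - y * (p * x + q * y)) (x * (s * x - r * y) - y * (q * x - p * y))
       (c * x + d * y) (d * x - c * y)"
    by (rule pole_matrix_rotate[OF v(1)])
  have "x * (p * x + q * y) + y * (r * x + s * y) = l"
    unfolding v(2,3) using v(1) by algebra
  moreover have "x * (r * x + s * y) - y * (p * x + q * y) = 0"
    unfolding v(2,3) by simp
  moreover have "x * (s * x - r * y) - y * (q * x - p * y) = p + s - l"
    using v by algebra
  ultimately have "B ** pole_matrix p q r s c d ** transpose B = pole_matrix
      l (x * (q * x - p * y) + y * (s * x - r * y)) 0 (p + s - l) (c * x + d * y) (d * x - c * y)"
    using B(2) by simp
  with cross_field_rotate[OF B(1), of "pole_matrix p q r s c d"] l c show thesis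
    by (intro that[OF B(1)]) auto
qed

text \<open>The parameters are \<open>a1 = c\<close>, \<open>a2 = d\<close>,
  \<open>a5 = - s\<close>, \<open>a7 = p\<close>, \<open>a8 = q\<close>. Family (ii) is exactly the
  case in which the second inequality of family (i) fails, which determines
  \<open>q\<close>.\<close>

lemma family_i_or_ii_cross_field:
  assumes "c \<noteq> 0" "p * s < 0"
  shows "family_i (cross_field (pole_matrix p q 0 s c d)) \<or> family_ii (cross_field (pole_matrix p q 0 s c d))"
proof -
  let ?Y = "cross_field (pole_matrix p q 0 s c d)"
  have Y: "?Y (vector [x, y, z]) = vector
           [- s * y * z - y * (- c * x - d * y),
            x * (- c * x - d * y) - z * (- p * x - q * y),
            y * (- p * x - q * y) - - s * x * y]" for x y z
    by (simp add: vec_eq_iff forall_3 cross_field_pole_matrix algebra_simps)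
  have ps: "- (- s * p) < 0" using assms(2) by (simp add: mult.commute)
  show ?thesis
  proof (cases "d * (- s + p) - c * q = 0")
    case True
    then have "q = d * (- s + p) / c" using assms(1) by (simp add: field_simps)
    with Y ps assms(1) have "family_ii ?Y"
      unfolding family_ii_def by (intro exI[of _ c] exI[of _ d] exI[of _ "- s"] exI[of _ p]) simp
    then show ?thesis ..
  next
    case False
    with Y ps assms(1) have "family_i ?Y"
      unfolding family_i_def
      by (intro exI[of _ c] exI[of _ d] exI[of _ "- s"] exI[of _ p] exI[of _ q]) simp
    then show ?thesis ..
  qed
qed

lemma orthogonal_transformation_rotation_matrix:
  fixes A :: "real^'n^'n"
  shows "rotation_matrix A \<Longrightarrow> orthogonal_transformation ((*v) A)"
  unfolding rotation_matrix_def orthogonal_transformation_matrix by simp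

theorem mainTheorem7:
  fixes X :: "real^3 \<Rightarrow> real^3"
  assumes "homogeneous_poly_vector_field 2 X"
    and "\<exists>\<gamma>. limit_cycle X \<gamma>"
  shows "\<exists>T. orthogonal_transformation T \<and>
           (family_i (change_variables T X) \<or> family_ii (change_variables T X))"
proof -
  obtain M where M: "X = cross_field M"
    by (rule homogeneous_quadratic_field_eq_cross_field[OF assms(1)])
  obtain \<gamma> where \<gamma>: "limit_cycle X \<gamma>" using assms(2) by blast
  obtain A p q r s c d where A: "rotation_matrix A"
    "\<And>v. A *v X v = cross_field (pole_matrix p q r s c d) (A *v v)"
    and cases: "(p - s)\<^sup>2 + 4 * q * r \<le> 0 \<or> p * s - q * r < 0"
    using cross_field_normal_form[of M] unfolding M by metis
  note \<gamma>' = limit_cycle_conjugate[OF orthogonal_transformation_rotation_matrix[OF A(1)] A(2) \<gamma>]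
  then have saddle: "p * s - q * r < 0"
    using cases no_limit_cycle_if_semidefinite by blast
  obtain B p' q' s' c' d' where B: "rotation_matrix B"
    "\<And>v. B *v cross_field (pole_matrix p q r s c d) v = cross_field (pole_matrix p' q' 0 s' c' d') (B *v v)"
    and ps: "p' * s' < 0" and c': "c' \<noteq> 0 \<or> c' = 0 \<and> d' = 0"
    using cross_field_saddle_normal_form[OF saddle, where c = c and d = d] by blast
  note limit_cycle_conjugate[OF orthogonal_transformation_rotation_matrix[OF B(1)] B(2) \<gamma>']
  then have "c' \<noteq> 0"
    using c' no_limit_cycle_if_block_diagonal[OF ps] by blast
  define T where "T = (*v) B \<circ> (*v) A"
  have T: "orthogonal_transformation T"
    unfolding T_def by (intro orthogonal_transformation_compose
        orthogonal_transformation_rotation_matrix A B)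
  have "change_variables T X = cross_field (pole_matrix p' q' 0 s' c' d')"
  proof
    fix w
    have "T (X (inv T w)) = cross_field (pole_matrix p' q' 0 s' c' d') (T (inv T w))"
      by (simp add: T_def A(2) B(2))
    then show "change_variables T X w = cross_field (pole_matrix p' q' 0 s' c' d') w"
      using orthogonal_transformation_surj[OF T] by (simp add: change_variables_def surj_f_inv_f)
  qed
  then show ?thesis
    using T family_i_or_ii_cross_field[OF \<open>c' \<noteq> 0\<close> ps] by metis
qed

end
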